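(* For every integer $k\geq 3$ and every real $\mu\in(0,\frac{k-1}{k})$ there is a set of natural numbers $X\subseteq\mathbb{N}$ such that (i) for every $r\geq 1$, every colouring of $X$ with $r$ colours contains a monochromatic arithmetic progression of length $k$, and (ii) every finite subset $Y\subseteq X$ contains a subset $Z\subseteq Y$ of size $|Z|\geq\mu|Y|$ that contains no arithmetic progression of length $k$.
   Context: An arithmetic progression of length $k$ is a set $\{a, a+d, a+2d,\dots,a+(k-1)d\}$ of integers with $d$ a positive integer (so it consists of $k$ distinct numbers). *)

theory Defs
  imports Complex_Main
begin

definition is_AP :: "nat \<Rightarrow> nat set \<Rightarrow> bool" where
  "is_AP k P \<longleftrightarrow> (\<exists>a d. d > 0 \<and> P = {a + i * d | i. i < k})"

definition contains_AP :: "nat \<Rightarrow> nat set \<Rightarrow> bool" where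
  "contains_AP k S \<longleftrightarrow> (\<exists>P. P \<subseteq> S \<and> is_AP k P)"

end

theory Submission
  imports Defs "HOL-Library.FuncSet" "HOL-Library.Ramsey" "HOL-Combinatorics.Permutations"
begin

text \<open>
  It suffices to treat each number \<open>r\<close> of colours by a finite set: sufficiently separated translates of
  these sets create no new progressions of length at least three.

  Start with a linear \<open>k\<close>-uniform hypergraph of chromatic number larger than \<open>r\<close> in which every weighting
  has an independent set carrying a \<open>\<mu>\<close>-fraction of the weight. Its vertices are \<open>t\<close>-sets of integers,
  its edges are suitable \<open>k\<close>-tuples of \<open>t\<close>-subsets of \<open>m\<close>-sets. Ramsey's theorem bounds the chromatic number,
  and the independent set consists of those \<open>t\<close>-sets in which the largest element
  with respect to a random permutation has a rank not divisible by \<open>k\<close>.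

  A partite construction turns this hypergraph into a set of integers: there are a finite set \<open>P\<close> and a
  projection of \<open>P\<close> to the vertices such that every progression in \<open>P\<close> projects onto an edge, while
  every \<open>r\<close>-colouring of \<open>P\<close> admits an affine copy of disjoint progressions, one over each edge, on which
  colours depend on the projection only. Independent sets pull back to progression-free sets. The fibres are
  made monochromatic one by one with the Hales-Jewett theorem, writing words over a fibre as integers
  in a large base. For \<open>k = 3\<close> this could create progressions running in opposite directions in
  different digits; they require three lines one of whose active sets is the disjoint union of the other two,
  so a version of Hales-Jewett avoiding such triples is used.
\<close>

section \<open>A sparse Hales-Jewett theorem\<close>

definition words :: "'a set \<Rightarrow> nat \<Rightarrow> 'a list set" where
  "words A n = {w. set w \<subseteq> A \<and> length w = n}"

lemma finite_words: "finite A \<Longrightarrow> finite (words A n)"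
  unfolding words_def by (rule finite_lists_length_eq)

definition fill :: "'a option list \<Rightarrow> 'a \<Rightarrow> 'a list" where
  "fill l a = map (case_option a id) l"

text \<open>A list over \<open>'a option\<close> encodes a combinatorial line, with \<open>None\<close> at the active coordinates.
  Schur-freeness says that no active set is the disjoint union of two others.\<close>

definition schur_free :: "'a option list set \<Rightarrow> bool" where
  "schur_free L \<longleftrightarrow> (\<forall>l0\<in>L. \<forall>l1\<in>L. \<forall>l2\<in>L. \<not> (\<forall>i<length l1.
     (l1 ! i = None \<longleftrightarrow> l0 ! i = None \<or> l2 ! i = None) \<and> \<not> (l0 ! i = None \<and> l2 ! i = None)))"

text \<open>The family is fixed before the colouring. The amalgamation uses the points of all lines
  in \<open>L\<close>, so Schur-freeness must hold across the whole family, not just for the line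
  that a colouring selects.\<close>

definition line_family :: "'a set \<Rightarrow> nat \<Rightarrow> nat \<Rightarrow> 'a option list set \<Rightarrow> bool" where
  "line_family A n r L \<longleftrightarrow>
     (\<forall>l\<in>L. length l = n \<and> None \<in> set l \<and> set l \<subseteq> insert None (Some ` A)) \<and> schur_free L \<and>
     (\<forall>c :: 'a list \<Rightarrow> nat. (\<forall>w\<in>words A n. c w < r) \<longrightarrow>
        (\<exists>l\<in>L. \<forall>a\<in>A. \<forall>b\<in>A. c (fill l a) = c (fill l b)))"

lemma fill_in_words:
  assumes "set l \<subseteq> insert None (Some ` A)" "A \<subseteq> A'" "a \<in> A'"
  shows "fill l a \<in> words A' (length l)"
  using assms by (fastforce simp: fill_def words_def split: option.splits)

lemma line_family_coloring:
  assumes L: "line_family A n r L" and C: "f ` words A n \<subseteq> C" "finite C" "card C \<le> r"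
  shows "\<exists>l\<in>L. \<forall>a\<in>A. \<forall>b\<in>A. f (fill l a) = f (fill l b)"
proof -
  obtain g :: "_ \<Rightarrow> nat" where g: "inj_on g C" "g ` C \<subseteq> {..<r}"
    using inj_on_iff_card_le[OF C(2), of "{..<r}"] C(3) by auto
  have "\<forall>w\<in>words A n. g (f w) < r" using g C(1) by blast
  then obtain l where l: "l \<in> L" "\<forall>a\<in>A. \<forall>b\<in>A. g (f (fill l a)) = g (f (fill l b))"
    using L unfolding line_family_def by (elim conjE allE[of _ "\<lambda>w. g (f w)"]) blast
  have "fill l a \<in> words A n" if "a \<in> A" for a
    using L l(1) that fill_in_words[of l A A a] unfolding line_family_def by auto
  then have "f (fill l a) = f (fill l b)" if "a \<in> A" "b \<in> A" for a b
    using l(2) g(1) C(1) that by (meson image_subset_iff inj_onD)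
  with l(1) show ?thesis by blast
qed

text \<open>Edges point upwards, so every triangle has the form a < b < c. The edges will become
  intervals of parameters in the Hales-Jewett induction.\<close>

lemma triangle_free_graph_large_chromatic:
  obtains m :: nat and T :: "(nat \<times> nat) set"
  where "\<And>a b. (a, b) \<in> T \<Longrightarrow> a < b \<and> b \<le> m"
    and "\<And>a b c. (a, b) \<in> T \<Longrightarrow> (b, c) \<in> T \<Longrightarrow> (a, c) \<notin> T"
    and "\<And>f :: nat \<Rightarrow> nat. (\<And>a. a \<le> m \<Longrightarrow> f a < r) \<Longrightarrow> \<exists>(a, b)\<in>T. f a = f b"
proof
  define N :: nat where "N = 2 ^ r + 1"
  \<comment> \<open>The shift graph, with edges from \<open>(i, j)\<close> to \<open>(j, l)\<close>, where pairs are coded in base \<open>N\<close>.\<close>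
  define T where "T = {(i * N + j, j * N + l) | i j l. i < j \<and> j < l \<and> l < N}"
  have less: "i * N + j < N * N" if "i < N" "j < N" for i j
  proof -
    have "i * N + j < (i + 1) * N" using that by simp
    also have "\<dots> \<le> N * N" using that by (intro mult_right_mono) auto
    finally show ?thesis .
  qed
  have digits: "i = i' \<and> j = j'" if "i * N + j = i' * N + j'" "j < N" "j' < N" for i j i' j'
  proof -
    have "(i * N + j) div N = (i' * N + j') div N" "(i * N + j) mod N = (i' * N + j') mod N"
      using that(1) by auto
    then show ?thesis using that(2,3) by simp
  qed
  show "a < b \<and> b \<le> N * N" if "(a, b) \<in> T" for a b
  proof -
    obtain i j l where *: "a = i * N + j" "b = j * N + l" "i < j" "j < l" "l < N"
      using \<open>(a, b) \<in> T\<close> by (auto simp: T_def)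
    have "(i + 1) * N \<le> j * N" using * by (intro mult_right_mono) auto
    then show ?thesis using * less[of j l] by auto
  qed
  show "(a, c) \<notin> T" if ab: "(a, b) \<in> T" and bc: "(b, c) \<in> T" for a b c
  proof
    assume "(a, c) \<in> T"
    then obtain i j l where 1: "a = i * N + j" "c = j * N + l" "i < j" "j < l" "l < N"
      by (auto simp: T_def)
    obtain i' j' l' where 2: "a = i' * N + j'" "b = j' * N + l'" "i' < j'" "j' < l'" "l' < N"
      using ab by (auto simp: T_def)
    obtain i'' j'' l'' where 3: "b = i'' * N + j''" "c = j'' * N + l''" "i'' < j''" "j'' < l''" "l'' < N"
      using bc by (auto simp: T_def)
    have "j = j'" using digits[of i j i' j'] 1 2 by simp
    moreover have "j = j''" using digits[of j l j'' l''] 1 3 by simp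
    moreover have "l' = j''" using digits[of j' l' i'' j''] 2 3 by simp
    ultimately show False using 2 by simp
  qed
  show "\<exists>(a, b)\<in>T. f a = f b" if f: "\<And>a. a \<le> N * N \<Longrightarrow> f a < r" for f :: "nat \<Rightarrow> nat"
  proof (rule ccontr)
    assume no: "\<not> ?thesis"
    \<comment> \<open>The colours on pairs ending in \<open>j\<close>. There are
      \<open>2 ^ r + 1\<close> indices but only \<open>2 ^ r\<close> sets of colours, so
      \<open>S j = S l\<close> for some j < l; the colour of the pair (j, l) then recurs on a pair
      (i, j), which is adjacent to it.\<close>
    define S where "S j = (\<lambda>i. f (i * N + j)) ` {..<j}" for j
    have "S ` {..<N} \<subseteq> Pow {..<r}"
      using f less by (fastforce simp: S_def less_imp_le)
    then have "card (S ` {..<N}) \<le> 2 ^ r"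
      using card_mono[of "Pow {..<r}"] by (simp add: card_Pow)
    then have "\<not> inj_on S {..<N}"
      using card_image[of S "{..<N}"] by (auto simp: N_def)
    then obtain j l where jl: "j < l" "l < N" "S j = S l"
      by (metis (no_types, lifting) inj_onI lessThan_iff linorder_neqE_nat)
    then have "f (j * N + l) \<in> S j" by (auto simp: S_def)
    then obtain i where "i < j" "f (i * N + j) = f (j * N + l)" by (auto simp: S_def)
    moreover have "(i * N + j, j * N + l) \<in> T" using jl \<open>i < j\<close> by (auto simp: T_def)
    ultimately show False using no by auto
  qed
qed

section \<open>Subspaces on which only the positions of one letter matter\<close>

definition inst :: "('a + nat) list \<Rightarrow> (nat \<Rightarrow> 'a) \<Rightarrow> 'a list" where
  "inst t s = map (case_sum id s) t"

text \<open>A word over \<open>'a + nat\<close> is a combinatorial subspace whose parameters are the indices under \<open>Inr\<close>;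
  parameter \<open>j\<close> occurs only in the block \<open>{i. blk i = j}\<close>, which is the same for all members of the family.
  Colourings become insensitive to changing parameter values within \<open>B\<close>, as in the usual
  induction on the alphabet, so only the positions of the new letter \<open>q\<close> matter.\<close>

definition insensitive_family :: "'a set \<Rightarrow> 'a \<Rightarrow> nat \<Rightarrow> nat \<Rightarrow> nat \<Rightarrow> ('a + nat) list set \<Rightarrow> (nat \<Rightarrow> nat) \<Rightarrow> bool" where
  "insensitive_family B q m n r F blk \<longleftrightarrow>
     (\<forall>t\<in>F. length t = n \<and> set t \<subseteq> Inl ` B \<union> Inr ` {..<m} \<and> (\<forall>j<m. Inr j \<in> set t) \<and>
        (\<forall>i<n. \<forall>j. t ! i = Inr j \<longrightarrow> blk i = j)) \<and>
     (\<forall>t0\<in>F. \<forall>t1\<in>F. \<forall>t2\<in>F. \<forall>j<m. \<not> (\<forall>i<n. blk i = j \<longrightarrow>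
        (t1 ! i = Inr j \<longleftrightarrow> t0 ! i = Inr j \<or> t2 ! i = Inr j) \<and> \<not> (t0 ! i = Inr j \<and> t2 ! i = Inr j))) \<and>
     (\<forall>c :: 'a list \<Rightarrow> nat. (\<forall>w\<in>words (insert q B) n. c w < r) \<longrightarrow>
        (\<exists>t\<in>F. \<forall>s s'. (\<forall>j. s j \<in> insert q B \<and> s' j \<in> insert q B \<and> (s j = q \<longleftrightarrow> s' j = q)) \<longrightarrow>
           c (inst t s) = c (inst t s')))"

lemma inst_in_words:
  assumes "set t \<subseteq> Inl ` B \<union> Inr ` J" "B \<subseteq> A" "\<And>j. s j \<in> A"
  shows "inst t s \<in> words A (length t)"
  using assms by (fastforce simp: inst_def words_def split: sum.splits)

text \<open>Induction on the number of parameters: the new one lives in a fresh block, along a line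
  over \<open>B\<close> on which all values in \<open>B\<close> have the same effect on the old
  coordinates.\<close>

lemma insensitive_family_exists:
  assumes hj: "\<And>r. \<exists>n L. line_family B n r L" and B: "finite B" "B \<noteq> {}" "q \<notin> B"
  shows "\<exists>n F blk. insensitive_family B q m n r F blk"
proof (induction m arbitrary: r)
  case 0
  show ?case
    by (rule exI[of _ 0], rule exI[of _ "{[]}"]) (simp add: insensitive_family_def inst_def)
next
  case (Suc m)
  let ?A = "insert q B"
  \<comment> \<open>\<open>r * r\<close> colours are needed because a word on the old coordinates
    will be coloured by a pair of colours.\<close>
  obtain n F blk where F: "insensitive_family B q m n (r * r) F blk" using Suc by blast
  \<comment> \<open>A word on the new block is coloured by the function that it induces on the words
    over the old coordinates, so \<open>n\<close> is fixed before \<open>n'\<close>.\<close>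
  define C where "C = words ?A n \<rightarrow>\<^sub>E {..<r}"
  have fC: "finite C" unfolding C_def by (intro finite_PiE finite_words) (use B in auto)
  obtain n' L where L: "line_family B n' (card C) L" using hj by blast
  define F' where "F' = {t @ map (case_option (Inr m) Inl) l | t l. t \<in> F \<and> l \<in> L}"
  define blk' where "blk' i = (if i < n then blk i else m)" for i
  note Fp = F[unfolded insensitive_family_def]
  have F1: "length t = n" "set t \<subseteq> Inl ` B \<union> Inr ` {..<m}" "\<And>j. j < m \<Longrightarrow> Inr j \<in> set t"
    "\<And>i j. i < n \<Longrightarrow> t ! i = Inr j \<Longrightarrow> blk i = j" if "t \<in> F" for t
    using Fp that by auto
  have L1: "length l = n'" "None \<in> set l" "set l \<subseteq> insert None (Some ` B)" if "l \<in> L" for l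
    using L that unfolding line_family_def by auto
  have nth': "(map (case_option (Inr m) Inl) l ! i = Inr m) = (l ! i = None)" if "i < n'" "l \<in> L" for l :: "'a option list" and i
    using that L1(1)[OF that(2)] by (auto split: option.splits)
  have "insensitive_family B q (Suc m) (n + n') r F' blk'"
    unfolding insensitive_family_def
  proof (intro conjI ballI allI impI)
    fix u assume "u \<in> F'"
    then obtain t l where u: "u = t @ map (case_option (Inr m) Inl) l" "t \<in> F" "l \<in> L"
      by (auto simp: F'_def)
    note t = F1[OF u(2)] and l = L1[OF u(3)]
    show "length u = n + n'" using u t l by simp
    show "set u \<subseteq> Inl ` B \<union> Inr ` {..<Suc m}"
    proof
      fix x assume "x \<in> set u"
      then consider "x \<in> set t" | o' where "o' \<in> set l" "x = case_option (Inr m) Inl o'" using u(1) by auto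
      then show "x \<in> Inl ` B \<union> Inr ` {..<Suc m}"
      proof cases
        case 1 then show ?thesis using t(2) by auto
      next
        case 2 then show ?thesis using l(3) by (cases o') auto
      qed
    qed
    show "Inr j \<in> set u" if "j < Suc m" for j
    proof (cases "j = m")
      case True then show ?thesis using u l(2) by (force simp: image_iff split: option.splits)
    next
      case False then show ?thesis using that u t(3)[of j] by auto
    qed
    show "blk' i = j" if "i < n + n'" "u ! i = Inr j" for i j
      using that u t(1) t(4)[of i j] l(1) by (auto simp: blk'_def nth_append split: if_splits option.splits)
  next
    fix u0 u1 u2 j assume u: "u0 \<in> F'" "u1 \<in> F'" "u2 \<in> F'" and j: "j < Suc m"
    obtain t0 l0 where 0: "u0 = t0 @ map (case_option (Inr m) Inl) l0" "t0 \<in> F" "l0 \<in> L"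
      using u by (auto simp: F'_def)
    obtain t1 l1 where 1: "u1 = t1 @ map (case_option (Inr m) Inl) l1" "t1 \<in> F" "l1 \<in> L"
      using u by (auto simp: F'_def)
    obtain t2 l2 where 2: "u2 = t2 @ map (case_option (Inr m) Inl) l2" "t2 \<in> F" "l2 \<in> L"
      using u by (auto simp: F'_def)
    show "\<not> (\<forall>i<n + n'. blk' i = j \<longrightarrow>
        (u1 ! i = Inr j \<longleftrightarrow> u0 ! i = Inr j \<or> u2 ! i = Inr j) \<and> \<not> (u0 ! i = Inr j \<and> u2 ! i = Inr j))"
    proof
      assume *: "\<forall>i<n + n'. blk' i = j \<longrightarrow>
        (u1 ! i = Inr j \<longleftrightarrow> u0 ! i = Inr j \<or> u2 ! i = Inr j) \<and> \<not> (u0 ! i = Inr j \<and> u2 ! i = Inr j)"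
      show False
      proof (cases "j = m")
        case True
        have "\<forall>i<length l1. (l1 ! i = None \<longleftrightarrow> l0 ! i = None \<or> l2 ! i = None) \<and> \<not> (l0 ! i = None \<and> l2 ! i = None)"
        proof (intro allI impI)
          fix i assume i: "i < length l1"
          then have i': "i < n'" using L1(1)[OF 1(3)] by simp
          show "(l1 ! i = None \<longleftrightarrow> l0 ! i = None \<or> l2 ! i = None) \<and> \<not> (l0 ! i = None \<and> l2 ! i = None)"
            using *[rule_format, of "n + i"] True i' nth'[OF i' 0(3)] nth'[OF i' 1(3)] nth'[OF i' 2(3)]
              F1(1)[OF 0(2)] F1(1)[OF 1(2)] F1(1)[OF 2(2)] 0(1) 1(1) 2(1)
            by (simp add: blk'_def nth_append)
        qed
        moreover have "schur_free L" using L by (simp add: line_family_def)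
        ultimately show False using 0 1 2 unfolding schur_free_def by blast
      next
        case False
        then have "j < m" using j by simp
        have "\<forall>i<n. blk i = j \<longrightarrow>
        (t1 ! i = Inr j \<longleftrightarrow> t0 ! i = Inr j \<or> t2 ! i = Inr j) \<and> \<not> (t0 ! i = Inr j \<and> t2 ! i = Inr j)"
        proof (intro allI impI)
          fix i assume i: "i < n" "blk i = j"
          show "(t1 ! i = Inr j \<longleftrightarrow> t0 ! i = Inr j \<or> t2 ! i = Inr j) \<and> \<not> (t0 ! i = Inr j \<and> t2 ! i = Inr j)"
            using *[rule_format, of i] i F1(1)[OF 0(2)] F1(1)[OF 1(2)] F1(1)[OF 2(2)] 0(1) 1(1) 2(1)
            by (simp add: blk'_def nth_append)
        qed
        then show False using Fp 0(2) 1(2) 2(2) \<open>j < m\<close> by blast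
      qed
    qed
  next
    fix c :: "'a list \<Rightarrow> nat" assume c: "\<forall>w\<in>words ?A (n + n'). c w < r"
    have app: "u @ w \<in> words ?A (n + n')" if "u \<in> words ?A n" "w \<in> words ?A n'" for u w
      using that by (auto simp: words_def)
    have BA: "w \<in> words ?A n'" if "w \<in> words B n'" for w using that by (auto simp: words_def)
    have "(\<lambda>w. restrict (\<lambda>u. c (u @ w)) (words ?A n)) ` words B n' \<subseteq> C"
      using c app BA by (auto simp: C_def)
    from line_family_coloring[OF L this fC order_refl]
    obtain l where l: "l \<in> L" "\<And>a b. a \<in> B \<Longrightarrow> b \<in> B \<Longrightarrow>
        restrict (\<lambda>u. c (u @ fill l a)) (words ?A n) = restrict (\<lambda>u. c (u @ fill l b)) (words ?A n)"
      by blast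
    have l2: "c (u @ fill l a) = c (u @ fill l b)" if "a \<in> B" "b \<in> B" "u \<in> words ?A n" for a b u
      using fun_cong[OF l(2)[OF that(1,2)], of u] that(3) by simp
    have fl: "fill l a \<in> words ?A n'" if "a \<in> ?A" for a
      using fill_in_words[of l B ?A a] L1[OF l(1)] that by auto
    obtain b0 where b0: "b0 \<in> B" using B by blast
    \<comment> \<open>Codes the colours obtained when the new parameter is \<open>b0\<close> or
      \<open>q\<close>; along \<open>l\<close>, the value \<open>b0\<close> represents every letter
      of \<open>B\<close>.\<close>
    define d where "d u = c (u @ fill l b0) * r + c (u @ fill l q)" for u
    have d1: "c (u @ fill l b0) < r" "c (u @ fill l q) < r" if "u \<in> words ?A n" for u
      using c app[OF that] fl b0 by auto
    have "d u < r * r" if "u \<in> words ?A n" for u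
    proof -
      have "d u < (c (u @ fill l b0) + 1) * r" using d1[OF that] by (simp add: d_def)
      also have "\<dots> \<le> r * r" using d1[OF that] by (intro mult_right_mono) auto
      finally show ?thesis .
    qed
    then have "\<exists>t\<in>F. \<forall>s s'. (\<forall>j. s j \<in> insert q B \<and> s' j \<in> insert q B \<and> (s j = q \<longleftrightarrow> s' j = q)) \<longrightarrow>
           d (inst t s) = d (inst t s')"
      using Fp by blast
    then obtain t where t: "t \<in> F" "\<And>s s'. (\<And>j. s j \<in> ?A \<and> s' j \<in> ?A \<and> (s j = q \<longleftrightarrow> s' j = q)) \<Longrightarrow>
           d (inst t s) = d (inst t s')"
      by metis
    let ?u = "t @ map (case_option (Inr m) Inl) l"
    have inst_u: "inst ?u s = inst t s @ fill l (s m)" for s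
      by (auto simp: inst_def fill_def split: option.splits)
    show "\<exists>t\<in>F'. \<forall>s s'. (\<forall>j. s j \<in> ?A \<and> s' j \<in> ?A \<and> (s j = q \<longleftrightarrow> s' j = q)) \<longrightarrow>
           c (inst t s) = c (inst t s')"
    proof (intro bexI[of _ ?u] allI impI)
      show "?u \<in> F'" using t l by (auto simp: F'_def)
      fix s s' :: "nat \<Rightarrow> 'a" assume s: "\<forall>j. s j \<in> ?A \<and> s' j \<in> ?A \<and> (s j = q \<longleftrightarrow> s' j = q)"
      have w: "inst t s \<in> words ?A n" "inst t s' \<in> words ?A n"
        unfolding F1(1)[OF t(1), symmetric]
        by (rule inst_in_words[OF F1(2)[OF t(1)] subset_insertI], use s in blast)+
      have "d (inst t s) = d (inst t s')" using t(2) s by blast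
      moreover have "c (u @ fill l b0) = d u div r" "c (u @ fill l q) = d u mod r" if "u \<in> words ?A n" for u
        using d1[OF that] by (auto simp: d_def)
      ultimately have e: "c (inst t s @ fill l b0) = c (inst t s' @ fill l b0)"
         "c (inst t s @ fill l q) = c (inst t s' @ fill l q)" using w by auto
      show "c (inst ?u s) = c (inst ?u s')"
      proof (cases "s m = q")
        case True
        then show ?thesis using s e(2) inst_u by metis
      next
        case False
        then have "s m \<in> B" "s' m \<in> B" using s by auto
        then show ?thesis using l2[OF _ b0 w(1), of "s m"] l2[OF _ b0 w(2), of "s' m"] e(1) inst_u by simp
      qed
    qed
  qed
  then show ?case by blast
qed

text \<open>Induction on the alphabet. After passing to an insensitive subspace, the staircase
  words, with \<open>q\<close> in the first \<open>a\<close> parameters and \<open>b0\<close> in the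
  rest, colour the numbers up to \<open>m\<close>; a monochromatic edge \<open>(a, b)\<close> then
  gives the line.\<close>

lemma sparse_Hales_Jewett:
  assumes "finite A" "A \<noteq> {}"
  shows "\<exists>n L. line_family A n r L"
  using assms
proof (induction A arbitrary: r rule: finite_ne_induct)
  case (singleton x)
  show ?case
    by (rule exI[of _ 1], rule exI[of _ "{[None]}"]) (simp add: line_family_def schur_free_def)
next
  case (insert q B)
  let ?A = "insert q B"
  obtain m T where T: "\<And>a b. (a, b) \<in> T \<Longrightarrow> a < b \<and> b \<le> m"
    "\<And>a b c. (a, b) \<in> T \<Longrightarrow> (b, c) \<in> T \<Longrightarrow> (a, c) \<notin> T"
    "\<And>f :: nat \<Rightarrow> nat. (\<And>a. a \<le> m \<Longrightarrow> f a < r) \<Longrightarrow> \<exists>(a, b)\<in>T. f a = f b"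
    using triangle_free_graph_large_chromatic by metis
  obtain n F blk where F: "insensitive_family B q m n r F blk"
    using insensitive_family_exists[of B q m r] insert by blast
  note Fp = F[unfolded insensitive_family_def]
  have F1: "length t = n" "set t \<subseteq> Inl ` B \<union> Inr ` {..<m}" "\<And>j. j < m \<Longrightarrow> Inr j \<in> set t"
    "\<And>i j. i < n \<Longrightarrow> t ! i = Inr j \<Longrightarrow> blk i = j" if "t \<in> F" for t
    using Fp that by auto
  obtain b0 where b0: "b0 \<in> B" using insert by blast
  \<comment> \<open>The active parameters form an interval \<open>[a, b)\<close> with \<open>(a, b)\<close> an edge of the triangle-free graph;
    a disjoint union of two such intervals would close a triangle.\<close>
  define cut where "cut a b j = (if j < a then Some q else if j < b then None else Some b0)" for a b j :: nat
  define line where "line t a b = map (case_sum Some (cut a b)) t" for t a b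
  define L where "L = {line t a b | t a b. t \<in> F \<and> (a, b) \<in> T}"
  have None_iff: "line t a b ! i = None \<longleftrightarrow> (\<exists>j. t ! i = Inr j \<and> a \<le> j \<and> j < b)" if "t \<in> F" "i < n" for t a b i
    using that F1(1)[OF that(1)] by (auto simp: line_def cut_def split: sum.splits if_splits)
  have "line_family ?A n r L"
    unfolding line_family_def
  proof (intro conjI ballI allI impI)
    fix l assume "l \<in> L"
    then obtain t a b where l: "l = line t a b" "t \<in> F" "(a, b) \<in> T" by (auto simp: L_def)
    note t = F1[OF l(2)]
    show "length l = n" using l t by (simp add: line_def)
    have ab: "a < b" "a < m" using T(1)[OF l(3)] by auto
    obtain i where "i < n" "t ! i = Inr a" using t(1) t(3)[OF ab(2)] by (auto simp: in_set_conv_nth)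
    then have "l ! i = None" using None_iff[OF l(2)] l(1) ab by auto
    then show "None \<in> set l" using \<open>i < n\<close> \<open>length l = n\<close> by (metis nth_mem)
    show "set l \<subseteq> insert None (Some ` ?A)"
      using t(2) b0 l(1) by (fastforce simp: line_def cut_def split: sum.splits)
  next
    show "schur_free L"
      unfolding schur_free_def
    proof (intro ballI notI)
      fix l0 l1 l2 assume "l0 \<in> L" "l1 \<in> L" "l2 \<in> L" and
        *: "\<forall>i<length l1. (l1 ! i = None \<longleftrightarrow> l0 ! i = None \<or> l2 ! i = None) \<and> \<not> (l0 ! i = None \<and> l2 ! i = None)"
      obtain t0 a0 b0 where 0: "l0 = line t0 a0 b0" "t0 \<in> F" "(a0, b0) \<in> T" using \<open>l0 \<in> L\<close> by (auto simp: L_def)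
      obtain t1 a1 b1 where 1: "l1 = line t1 a1 b1" "t1 \<in> F" "(a1, b1) \<in> T" using \<open>l1 \<in> L\<close> by (auto simp: L_def)
      obtain t2 a2 b2 where 2: "l2 = line t2 a2 b2" "t2 \<in> F" "(a2, b2) \<in> T" using \<open>l2 \<in> L\<close> by (auto simp: L_def)
      have len: "length l1 = n" using 1 F1 by (simp add: line_def)
      have blkN: "line t a b ! i = None \<longleftrightarrow> t ! i = Inr j \<and> a \<le> j \<and> j < b"
        if "t \<in> F" "i < n" "blk i = j" for t a b i j
        using None_iff[OF that(1,2), of a b] F1(4)[OF that(1,2)] that(3) by auto
      have star: "((t1 ! i = Inr j \<and> a1 \<le> j \<and> j < b1) \<longleftrightarrow> (t0 ! i = Inr j \<and> a0 \<le> j \<and> j < b0) \<or> (t2 ! i = Inr j \<and> a2 \<le> j \<and> j < b2))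
        \<and> \<not> ((t0 ! i = Inr j \<and> a0 \<le> j \<and> j < b0) \<and> (t2 ! i = Inr j \<and> a2 \<le> j \<and> j < b2))"
        if "i < n" "blk i = j" for i j
        using *[rule_format, of i] that len blkN[OF 0(2) that] blkN[OF 1(2) that] blkN[OF 2(2) that] 0(1) 1(1) 2(1)
        by simp
      have occ: "\<exists>i<n. t ! i = Inr j \<and> blk i = j" if "t \<in> F" "j < m" for t j
        using F1[OF that(1)] that(2) by (metis in_set_conv_nth)
      \<comment> \<open>Every parameter below \<open>m\<close> occurs in each template, inside its
        own block, so relations between active positions descend to the intervals; beyond
        \<open>m\<close> all intervals are empty.\<close>
      have iff: "(a1 \<le> j \<and> j < b1) \<longleftrightarrow> (a0 \<le> j \<and> j < b0) \<or> (a2 \<le> j \<and> j < b2)" for j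
      proof (cases "j < m")
        case True
        show ?thesis using occ[OF 0(2) True] occ[OF 1(2) True] occ[OF 2(2) True] star by metis
      next
        case False
        then show ?thesis using T(1)[OF 0(3)] T(1)[OF 1(3)] T(1)[OF 2(3)] by linarith
      qed
      \<comment> \<open>A common parameter \<open>j\<close> would be active in all three lines, and
        its occurrences within block \<open>j\<close> would violate the blockwise Schur condition of
        \<open>F\<close>.\<close>
      have disj: "\<not> ((a0 \<le> j \<and> j < b0) \<and> (a2 \<le> j \<and> j < b2))" for j
      proof
        assume j: "(a0 \<le> j \<and> j < b0) \<and> (a2 \<le> j \<and> j < b2)"
        then have j1: "a1 \<le> j \<and> j < b1" using iff by blast
        have jm: "j < m" using j T(1)[OF 0(3)] by linarith
        have "\<forall>i<n. blk i = j \<longrightarrow>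
        (t1 ! i = Inr j \<longleftrightarrow> t0 ! i = Inr j \<or> t2 ! i = Inr j) \<and> \<not> (t0 ! i = Inr j \<and> t2 ! i = Inr j)"
        proof (intro allI impI)
          fix i assume "i < n" "blk i = j"
          from star[OF this] show "(t1 ! i = Inr j \<longleftrightarrow> t0 ! i = Inr j \<or> t2 ! i = Inr j) \<and> \<not> (t0 ! i = Inr j \<and> t2 ! i = Inr j)"
            using j j1 by blast
        qed
        then show False using Fp 0(2) 1(2) 2(2) jm by blast
      qed
      have ne: "a0 < b0" "a1 < b1" "a2 < b2" using T(1) 0(3) 1(3) 2(3) by blast+
      have "(b0 = a2 \<and> a1 = a0 \<and> b1 = b2) \<or> (b2 = a0 \<and> a1 = a2 \<and> b1 = b0)"
      proof (cases "a0 < a2")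
        case True
        have "b0 \<le> a2" using disj[of a2] True ne by linarith
        moreover have "a1 = a0" using iff[of a0] iff[of a1] True ne by linarith
        moreover have "b1 = b2" using iff[of "b2 - 1"] iff[of "b1 - 1"] calculation ne by linarith
        moreover have "b0 = a2" using iff[of b0] calculation ne by linarith
        ultimately show ?thesis by blast
      next
        case False
        have "b2 \<le> a0" using disj[of a0] False ne by linarith
        moreover have "a1 = a2" using iff[of a2] iff[of a1] calculation ne by linarith
        moreover have "b1 = b0" using iff[of "b0 - 1"] iff[of "b1 - 1"] calculation ne by linarith
        moreover have "b2 = a0" using iff[of b2] calculation ne by linarith
        ultimately show ?thesis by blast
      qed
      then show False using T(2) 0(3) 1(3) 2(3) by metis
    qed
  next
    fix c :: "'a list \<Rightarrow> nat" assume c: "\<forall>w\<in>words ?A n. c w < r"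
    have "\<exists>t\<in>F. \<forall>s s'. (\<forall>j. s j \<in> ?A \<and> s' j \<in> ?A \<and> (s j = q \<longleftrightarrow> s' j = q)) \<longrightarrow>
           c (inst t s) = c (inst t s')"
      using Fp c by blast
    then obtain t where t: "t \<in> F" "\<And>s s'. (\<And>j. s j \<in> ?A \<and> s' j \<in> ?A \<and> (s j = q \<longleftrightarrow> s' j = q)) \<Longrightarrow>
           c (inst t s) = c (inst t s')"
      by metis
    define stair where "stair a j = (if j < a then q else b0)" for a j :: nat
    have "inst t (stair a) \<in> words ?A n" for a
      using inst_in_words[OF F1(2)[OF t(1)], of ?A "stair a"] F1(1)[OF t(1)] b0 by (simp add: stair_def subset_insertI)
    then obtain a b where ab: "(a, b) \<in> T" "c (inst t (stair a)) = c (inst t (stair b))"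
      using T(3)[of "\<lambda>a. c (inst t (stair a))"] c by auto
    have lab: "a < b" using T(1)[OF ab(1)] by simp
    have fill_line: "fill (line t a b) x = inst t (\<lambda>j. if j < a then q else if j < b then x else b0)" for x
      by (auto simp: fill_def line_def inst_def cut_def split: sum.splits)
    \<comment> \<open>The letter \<open>q\<close> turns the line into the staircase at
      \<open>b\<close>; any other letter lies in \<open>B\<close> and may be exchanged for
      \<open>b0\<close>, which gives the staircase at \<open>a\<close>.\<close>
    have "c (fill (line t a b) x) = c (inst t (stair a))" if "x \<in> ?A" for x
    proof (cases "x = q")
      case True
      then have "fill (line t a b) x = inst t (stair b)"
        unfolding fill_line stair_def using lab by (intro arg_cong[of _ _ "inst t"] ext) auto
      then show ?thesis using ab by simp
    next
      case False
      show ?thesis unfolding fill_line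
        by (rule t(2)) (use that False b0 insert in \<open>auto simp: stair_def\<close>)
    qed
    then show "\<exists>l\<in>L. \<forall>a\<in>?A. \<forall>b\<in>?A. c (fill l a) = c (fill l b)"
      using t(1) ab(1) by (intro bexI[of _ "line t a b"]) (auto simp: L_def)
  qed
  then show ?case by blast
qed

section \<open>A linear hypergraph with large independent sets\<close>

text \<open>Composing with the transposition of two elements of \<open>v\<close> exchanges their
  roles, so each element is the largest equally often; injectivity makes these events
  disjoint.\<close>

lemma card_permutations_max_at:
  fixes v :: "nat set"
  assumes v: "v \<subseteq> {..<N}" and a: "a \<in> v"
  shows "card {\<sigma>. \<sigma> permutes {..<N} \<and> (\<forall>b\<in>v. \<sigma> b \<le> \<sigma> a)} * card v = fact N"
proof -
  define D where "D a = {\<sigma>. \<sigma> permutes {..<N} \<and> (\<forall>b\<in>v. \<sigma> b \<le> \<sigma> a)}" for a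
  have finv: "finite v" using v finite_subset by blast
  have finP: "finite {\<sigma>. \<sigma> permutes {..<N}}" by (simp add: finite_permutations)
  have finD: "finite (D a)" for a by (rule finite_subset[OF _ finP]) (auto simp: D_def)
  have le: "card (D a) \<le> card (D b)" if "a \<in> v" "b \<in> v" for a b
  proof (rule card_inj_on_le[where f = "\<lambda>\<sigma>. \<sigma> \<circ> transpose a b"])
    show "inj_on (\<lambda>\<sigma>. \<sigma> \<circ> transpose a b) (D a)"
      by (rule inj_onI) (metis comp_assoc comp_id transpose_comp_involutory)
    show "(\<lambda>\<sigma>. \<sigma> \<circ> transpose a b) ` D a \<subseteq> D b"
    proof
      fix \<tau> assume "\<tau> \<in> (\<lambda>\<sigma>. \<sigma> \<circ> transpose a b) ` D a"
      then obtain \<sigma> where \<sigma>: "\<tau> = \<sigma> \<circ> transpose a b" "\<sigma> permutes {..<N}" "\<forall>b\<in>v. \<sigma> b \<le> \<sigma> a"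
        by (auto simp: D_def)
      have "\<tau> permutes {..<N}" unfolding \<sigma>(1)
        using that v \<sigma>(2) by (intro permutes_compose permutes_swap_id) auto
      moreover have "transpose a b x \<in> v" if "x \<in> v" for x
        using that \<open>a \<in> v\<close> \<open>b \<in> v\<close> by (auto simp: transpose_def)
      ultimately show "\<tau> \<in> D b" using \<sigma> by (auto simp: D_def)
    qed
  qed (rule finD)
  have eq: "card (D b) = card (D a)" if "b \<in> v" for b
    using le[OF that a] le[OF a that] by simp
  have "{\<sigma>. \<sigma> permutes {..<N}} = (\<Union>a\<in>v. D a)"
  proof (intro equalityI subsetI)
    fix \<sigma> assume "\<sigma> \<in> {\<sigma>. \<sigma> permutes {..<N}}"
    moreover have "Max (\<sigma> ` v) \<in> \<sigma> ` v" using finv a by (intro Max_in) auto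
    then obtain x where "x \<in> v" "\<sigma> x = Max (\<sigma> ` v)" by (metis imageE)
    moreover have "\<forall>b\<in>v. \<sigma> b \<le> \<sigma> x" using \<open>\<sigma> x = _\<close> finv by simp
    ultimately show "\<sigma> \<in> (\<Union>a\<in>v. D a)" unfolding D_def by blast
  qed (auto simp: D_def)
  moreover have "D x \<inter> D y = {}" if "x \<in> v" "y \<in> v" "x \<noteq> y" for x y
  proof -
    have False if "\<sigma> \<in> D x" "\<sigma> \<in> D y" for \<sigma>
    proof -
      have "\<sigma> x = \<sigma> y" using that \<open>x \<in> v\<close> \<open>y \<in> v\<close> by (auto simp: D_def intro: antisym)
      moreover have "inj \<sigma>" using that permutes_inj by (auto simp: D_def)
      ultimately show False using \<open>x \<noteq> y\<close> by (auto dest: injD)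
    qed
    then show ?thesis by blast
  qed
  ultimately have "card {\<sigma>. \<sigma> permutes {..<N}} = (\<Sum>x\<in>v. card (D x))"
    using card_UN_disjoint[of v D] finv finD by simp
  also have "\<dots> = card v * card (D a)" using eq by simp
  finally show ?thesis by (simp add: card_permutations[OF refl] D_def)
qed

definition el :: "nat set \<Rightarrow> nat \<Rightarrow> nat" where
  "el R i = sorted_list_of_set R ! i"

lemma el_less:
  assumes "finite R" "i < j" "j < card R"
  shows "el R i < el R j"
proof -
  have "sorted_wrt (<) (sorted_list_of_set R)" by (rule strict_sorted_list_of_set)
  then show ?thesis unfolding el_def using assms sorted_wrt_nth_less[of "(<)" "sorted_list_of_set R" i j]
    by (simp add: sorted_list_of_set.length_sorted_key_list_of_set)
qed

lemma el_less_iff: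
  assumes "finite R" "i < card R" "j < card R"
  shows "el R i < el R j \<longleftrightarrow> i < j"
  by (metis assms el_less linorder_neqE_nat order_less_asym)

lemma inj_on_el: "finite R \<Longrightarrow> inj_on (el R) {..<card R}"
  by (rule inj_onI) (metis el_less lessThan_iff less_irrefl linorder_neqE_nat)

lemma el_image: "finite R \<Longrightarrow> el R ` {..<card R} = R"
  unfolding el_def
  by (metis (no_types, lifting) atLeast_upt image_cong image_set map_nth set_sorted_list_of_set
      sorted_list_of_set.length_sorted_key_list_of_set)

section \<open>Windows in finite sets of natural numbers\<close>

locale window_hypergraph =
  fixes k n :: nat
  assumes k3: "k \<ge> 3"
begin

text \<open>The margins of length \<open>s\<close> at both ends hold the \<open>k\<close> disjoint
  gaps. The middle length \<open>k * n\<close> can be made large enough for the margins to be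
  negligible, and \<open>k - 1\<close> is the size of a gap.\<close>

definition s :: nat where "s = k * k"
definition t :: nat where "t = 2 * s + k * n"
definition m :: nat where "m = t + (k - 1)"

text \<open>An edge consists of the \<open>k\<close> windows obtained from an \<open>m\<close>-set by deleting \<open>gap 0, \<dots>, gap (k - 1)\<close>.
  The gaps are disjoint, so two windows determine the \<open>m\<close>-set, and \<open>gap j\<close> deletes exactly \<open>j\<close> of the
  first \<open>s\<close> positions, so an element in the middle has a different rank modulo \<open>k\<close> in each window.\<close>

definition gap :: "nat \<Rightarrow> nat set" where
  "gap j = (\<lambda>i. j * k + i) ` {..<j} \<union> (\<lambda>i. m - 1 - (j * k + i)) ` {..<k - 1 - j}"

lemma sm: "2 * s \<le> t" "2 * s \<le> m" "m = t + (k - 1)" "s \<ge> k"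
  using k3 by (auto simp: m_def t_def s_def)

lemma low_less: "j * k + i < s" if "j < k" "i < k" for i j
proof -
  have "j * k + i < (j + 1) * k" using that by simp
  also have "\<dots> \<le> s" unfolding s_def using that by (intro mult_right_mono) auto
  finally show ?thesis .
qed

lemma digits: "j = j' \<and> i = i'" if "j * k + i = j' * k + i'" "i < k" "i' < k" for i j i' j' :: nat
proof -
  have "(j * k + i) div k = (j' * k + i') div k" "(j * k + i) mod k = (j' * k + i') mod k" using that(1) by auto
  then show ?thesis using that(2,3) by simp
qed

lemma gap_low: "j < k \<Longrightarrow> gap j \<inter> {..<s} = (\<lambda>i. j * k + i) ` {..<j}"
  and gap_high: "j < k \<Longrightarrow> gap j - {..<s} = (\<lambda>i. m - 1 - (j * k + i)) ` {..<k - 1 - j}"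
  and gap_sub: "j < k \<Longrightarrow> gap j \<subseteq> {..<s} \<union> {m - s..<m}"
proof -
  assume j: "j < k"
  have 1: "j * k + i < s" if "i < j" for i using low_less[of j i] j that by simp
  have 2: "m - s \<le> m - 1 - (j * k + i)" "m - 1 - (j * k + i) < m" "s \<le> m - 1 - (j * k + i)" if "i < k - 1 - j" for i
  proof -
    have "j * k + i < s" using low_less[of j i] j that by simp
    then show "m - s \<le> m - 1 - (j * k + i)" "m - 1 - (j * k + i) < m" "s \<le> m - 1 - (j * k + i)"
      using sm k3 by linarith+
  qed
  show "gap j \<inter> {..<s} = (\<lambda>i. j * k + i) ` {..<j}" using 1 2(3) by (fastforce simp: gap_def)
  show "gap j - {..<s} = (\<lambda>i. m - 1 - (j * k + i)) ` {..<k - 1 - j}" using 1 2(3) by (fastforce simp: gap_def)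
  show "gap j \<subseteq> {..<s} \<union> {m - s..<m}" using 1 2 by (auto simp: gap_def)
qed

lemma finite_gap: "finite (gap j)" by (simp add: gap_def)

lemma card_low: "j < k \<Longrightarrow> card (gap j \<inter> {..<s}) = j"
  by (simp add: gap_low card_image inj_on_def)

lemma card_gap: assumes "j < k" shows "card (gap j) = k - 1"
proof -
  have "inj_on (\<lambda>i. m - 1 - (j * k + i)) {..<k - 1 - j}"
  proof (rule inj_onI)
    fix x y assume "x \<in> {..<k - 1 - j}" "y \<in> {..<k - 1 - j}" "m - 1 - (j * k + x) = m - 1 - (j * k + y)"
    moreover have "j * k + x < s" "j * k + y < s" using calculation low_less assms by simp_all
    ultimately show "x = y" using sm k3 by linarith
  qed
  then have "card (gap j - {..<s}) = k - 1 - j" using gap_high[OF assms] by (simp add: card_image)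
  then show ?thesis using card_low[OF assms] card_Int_Diff[OF finite_gap[of j], of "{..<s}"] assms by simp
qed

lemma gap_disjoint: assumes "i < k" "j < k" "i \<noteq> j" shows "gap i \<inter> gap j = {}"
proof (rule ccontr)
  assume "gap i \<inter> gap j \<noteq> {}"
  then obtain x where x: "x \<in> gap i" "x \<in> gap j" by blast
  show False
  proof (cases "x < s")
    case True
    then have "x \<in> gap i \<inter> {..<s}" "x \<in> gap j \<inter> {..<s}" using x by auto
    then obtain a b where "x = i * k + a" "a < i" "x = j * k + b" "b < j"
      unfolding gap_low[OF assms(1)] gap_low[OF assms(2)] by blast
    then show False using digits[of i a j b] assms by simp
  next
    case False
    then have "x \<in> gap i - {..<s}" "x \<in> gap j - {..<s}" using x by auto
    then obtain a b where ab: "x = m - 1 - (i * k + a)" "a < k - 1 - i" "x = m - 1 - (j * k + b)" "b < k - 1 - j"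
      unfolding gap_high[OF assms(1)] gap_high[OF assms(2)] by blast
    have "i * k + a < s" "j * k + b < s" using ab low_less assms by auto
    then have "i * k + a = j * k + b" using ab(1,3) sm k3 by linarith
    moreover have "a < k" "b < k" using ab by simp_all
    ultimately show False using digits[of i a j b] assms by blast
  qed
qed

definition win :: "nat set \<Rightarrow> nat \<Rightarrow> nat set" where
  "win R j = el R ` ({..<m} - gap j)"

definition edge :: "nat set \<Rightarrow> nat set set" where "edge R = win R ` {..<k}"

lemma win_nsets:
  assumes "R \<in> nsets S m" "j < k"
  shows "win R j \<in> nsets S t"
proof -
  have R: "finite R" "card R = m" "R \<subseteq> S" using assms by (auto simp: nsets_def)
  have "gap j \<subseteq> {..<m}" using gap_sub[OF assms(2)] sm by auto
  then have "card ({..<m} - gap j) = t" using card_Diff_subset[OF finite_gap] card_gap[OF assms(2)] sm by simp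
  moreover have "inj_on (el R) ({..<m} - gap j)" using inj_on_el[OF R(1)] R(2) by (auto intro: inj_on_subset)
  moreover have "win R j \<subseteq> S" using el_image[OF R(1)] R by (auto simp: win_def)
  ultimately show ?thesis by (simp add: nsets_def win_def card_image)
qed

lemma win_Un:
  assumes "R \<in> nsets S m" "i < k" "j < k" "i \<noteq> j"
  shows "win R i \<union> win R j = R"
proof -
  have R: "finite R" "card R = m" "R \<subseteq> S" using assms by (auto simp: nsets_def)
  have "({..<m} - gap i) \<union> ({..<m} - gap j) = {..<m}" using gap_disjoint[OF assms(2-4)] by blast
  then show ?thesis using el_image[OF R(1)] R(2) by (simp add: win_def image_Un[symmetric])
qed

lemma inj_on_win: assumes "R \<in> nsets S m" shows "inj_on (win R) {..<k}"
proof (rule inj_onI, rule ccontr)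
  fix i j assume ij: "i \<in> {..<k}" "j \<in> {..<k}" "win R i = win R j" "i \<noteq> j"
  then have "win R i = R" using win_Un[OF assms, of i j] by simp
  then have "card R = t" using win_nsets[OF assms, of i] ij by (simp add: nsets_def)
  then have "m = t" using assms by (simp add: nsets_def)
  then show False using sm(3) k3 by linarith
qed

text \<open>A window is selected according to the rank of its \<open>\<sigma>\<close>-largest element. For a random permutation
  this rank is uniform, and the largest element of an \<open>m\<close>-set takes rank \<open>0\<close> modulo \<open>k\<close> in one of its windows.\<close>

definition ok :: "nat \<Rightarrow> bool" where "ok p \<longleftrightarrow> s \<le> p \<and> p < t - s \<and> p mod k \<noteq> 0"

definition indep_wins :: "nat \<Rightarrow> (nat \<Rightarrow> nat) \<Rightarrow> nat set set" where
  "indep_wins N \<sigma> = {v \<in> nsets {..<N} t. \<exists>a\<in>v. (\<forall>b\<in>v. \<sigma> b \<le> \<sigma> a) \<and> ok (card {b \<in> v. b < a})}"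

text \<open>The largest element of \<open>R\<close> under \<open>\<sigma>\<close>, at position
  \<open>e\<close>, is also the largest of each window containing it. The margins in
  \<open>ok\<close> force \<open>e\<close> into the middle, where its rank in window
  \<open>i\<close> is \<open>e - i\<close>.\<close>

lemma edge_not_subset_indep:
  assumes R: "R \<in> nsets S m" and \<sigma>: "inj \<sigma>"
  shows "\<not> edge R \<subseteq> indep_wins N \<sigma>"
proof
  assume sub: "edge R \<subseteq> indep_wins N \<sigma>"
  have R': "finite R" "card R = m" using R by (auto simp: nsets_def)
  have m0: "m > 0" using sm k3 by linarith
  have "Max (\<sigma> ` R) \<in> \<sigma> ` R" using R' m0 by (intro Max_in) auto
  then obtain x where x: "x \<in> R" "\<sigma> x = Max (\<sigma> ` R)" by (metis imageE)
  then obtain e where e: "e < m" "x = el R e" using el_image[OF R'(1)] R' by auto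
  have max: "\<sigma> b \<le> \<sigma> x" if "b \<in> R" for b using x that R' by simp
  have winR: "win R j \<subseteq> R" for j using el_image[OF R'(1)] R' by (auto simp: win_def)
  have okj: "ok (card ({..<e} - gap j))" if j: "j < k" "e \<notin> gap j" for j
  proof -
    have "win R j \<in> indep_wins N \<sigma>" using sub j by (auto simp: edge_def)
    then obtain a where a: "a \<in> win R j" "\<forall>b\<in>win R j. \<sigma> b \<le> \<sigma> a" "ok (card {b \<in> win R j. b < a})"
      by (auto simp: indep_wins_def)
    have "x \<in> win R j" using e j by (auto simp: win_def)
    then have "\<sigma> x = \<sigma> a" using a max winR by (meson antisym subsetD)
    then have "a = x" using \<sigma> by (auto dest: injD)
    moreover have "{b \<in> win R j. b < x} = el R ` ({..<e} - gap j)"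
      using e el_less_iff[OF R'(1)] R'(2) by (auto simp: win_def)
    moreover have "inj_on (el R) ({..<e} - gap j)"
      using inj_on_el[OF R'(1)] R'(2) e by (auto intro: inj_on_subset)
    ultimately show ?thesis using a(3) by (simp add: card_image)
  qed
  have "\<exists>j<k. e \<notin> gap j"
    using gap_disjoint[of 0 1] k3 by (metis (no_types, lifting) IntI One_nat_def Suc_lessD empty_iff
        le_simps(3) less_le_trans numeral_3_eq_3 zero_less_Suc zero_neq_one)
  then obtain j where j: "j < k" "e \<notin> gap j" by blast
  let ?p = "card ({..<e} - gap j)"
  have p: "s \<le> ?p" "?p < t - s" using okj[OF j] by (auto simp: ok_def)
  have "?p \<le> card {..<e}" by (intro card_mono) auto
  then have es: "s \<le> e" using p by simp
  have "e < m - s"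
  proof (rule ccontr)
    assume "\<not> e < m - s"
    have "card ({..<m} - gap j) \<le> card (({..<e} - gap j) \<union> {e..<m})" by (intro card_mono) auto
    also have "\<dots> \<le> ?p + card {e..<m}" by (rule card_Un_le)
    finally have "card ({..<m} - gap j) \<le> ?p + (m - e)" by simp
    moreover have "gap j \<subseteq> {..<m}" using gap_sub[OF j(1)] sm by auto
    then have "card ({..<m} - gap j) = t" using card_Diff_subset[OF finite_gap] card_gap[OF j(1)] sm by simp
    ultimately show False using p \<open>\<not> e < m - s\<close> sm by linarith
  qed
  have mid: "card ({..<e} - gap i) = e - i" if "i < k" for i
  proof -
    have "gap i \<inter> {..<e} = gap i \<inter> {..<s}" using gap_sub[OF that] \<open>e < m - s\<close> es by fastforce
    then have "card ({..<e} \<inter> gap i) = i" using card_low[OF that] by (simp add: Int_commute)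
    then show ?thesis by (simp add: card_Diff_subset_Int)
  qed
  \<comment> \<open>Window \<open>e mod k\<close> gives rank \<open>e - e mod k\<close>, a multiple
    of \<open>k\<close>, which \<open>ok\<close> excludes.\<close>
  have "e mod k < k" using k3 by simp
  moreover have "e \<notin> gap (e mod k)" using gap_sub[OF calculation] \<open>e < m - s\<close> es by auto
  ultimately have "ok (e - e mod k)" using okj mid by metis
  then show False by (simp add: ok_def minus_mod_eq_mult_div)
qed

text \<open>Since \<open>s\<close> is a multiple of \<open>k\<close>, the middle splits into
  \<open>n\<close> runs of \<open>k\<close> ranks, and in each run only the first is divisible by
  \<open>k\<close>.\<close>

lemma card_ok: "card {p. p < t \<and> ok p} \<ge> n * (k - 1)"
proof -
  let ?g = "\<lambda>(i, j). s + (i * k + j)"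
  have "inj_on ?g ({..<n} \<times> {1..<k})"
  proof (rule inj_onI, clarify)
    fix i j i' j' assume "j \<in> {1..<k}" "j' \<in> {1..<k}" "s + (i * k + j) = s + (i' * k + j')"
    then show "i = i' \<and> j = j'" using digits[of i j i' j'] by simp
  qed
  then have "card (?g ` ({..<n} \<times> {1..<k})) = n * (k - 1)"
    by (simp add: card_image card_cartesian_product)
  moreover have "?g ` ({..<n} \<times> {1..<k}) \<subseteq> {p. p < t \<and> ok p}"
  proof
    fix p assume "p \<in> ?g ` ({..<n} \<times> {1..<k})"
    then obtain i j where p: "p = s + (i * k + j)" "i < n" "1 \<le> j" "j < k" by auto
    have "i * k + j < (i + 1) * k" using p by simp
    also have "\<dots> \<le> n * k" using p by (intro mult_right_mono) auto
    finally have "i * k + j < k * n" by (simp add: mult.commute)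
    moreover have "p mod k = j"
    proof -
      have "p = (k + i) * k + j" using p(1) by (simp add: s_def algebra_simps)
      then show ?thesis using p(4) by simp
    qed
    ultimately show "p \<in> {p. p < t \<and> ok p}" using p by (auto simp: ok_def t_def)
  qed
  ultimately show ?thesis using card_mono[of "{p. p < t \<and> ok p}" "?g ` ({..<n} \<times> {1..<k})"] by simp
qed

text \<open>Sums \<open>card_permutations_max_at\<close> over the elements of \<open>v\<close> with
  selected rank: a random permutation selects \<open>v\<close> with probability at least
  \<open>n * (k - 1) / t\<close>.\<close>

lemma card_permutations_indep:
  assumes v: "v \<in> nsets {..<N} t"
  shows "card {\<sigma>. \<sigma> permutes {..<N} \<and> v \<in> indep_wins N \<sigma>} * t \<ge> n * (k - 1) * fact N"
proof -
  define D where "D a = {\<sigma>. \<sigma> permutes {..<N} \<and> (\<forall>b\<in>v. \<sigma> b \<le> \<sigma> a)}" for a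
  define G where "G = {a \<in> v. ok (card {b \<in> v. b < a})}"
  have v': "finite v" "card v = t" "v \<subseteq> {..<N}" using v by (auto simp: nsets_def)
  have eq: "{\<sigma>. \<sigma> permutes {..<N} \<and> v \<in> indep_wins N \<sigma>} = (\<Union>a\<in>G. D a)"
    using v by (auto simp: indep_wins_def D_def G_def)
  have finP: "finite {\<sigma>. \<sigma> permutes {..<N}}" by (simp add: finite_permutations)
  have finD: "finite (D a)" for a by (rule finite_subset[OF _ finP]) (auto simp: D_def)
  have disj: "D x \<inter> D y = {}" if "x \<in> G" "y \<in> G" "x \<noteq> y" for x y
  proof -
    have False if "\<sigma> \<in> D x" "\<sigma> \<in> D y" for \<sigma>
    proof -
      have "\<sigma> x = \<sigma> y" using that \<open>x \<in> G\<close> \<open>y \<in> G\<close> by (auto simp: D_def G_def intro: antisym)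
      moreover have "inj \<sigma>" using that permutes_inj by (auto simp: D_def)
      ultimately show False using \<open>x \<noteq> y\<close> by (auto dest: injD)
    qed
    then show ?thesis by blast
  qed
  have "G = el v ` {p. p < t \<and> ok p}"
  proof -
    have "{b \<in> v. b < el v p} = el v ` {..<p}" if "p < t" for p
    proof -
      have "{b \<in> el v ` {..<card v}. b < el v p} = el v ` {..<p}"
        using that el_less_iff[OF v'(1)] v'(2) by auto
      then show ?thesis using el_image[OF v'(1)] by simp
    qed
    moreover have "card (el v ` {..<p}) = p" if "p < t" for p
      using that inj_on_el[OF v'(1)] v'(2) card_image[of "el v" "{..<p}"]
      by (metis card_lessThan inj_on_subset lessThan_subset_iff less_imp_le)
    ultimately have rk: "card {b \<in> v. b < el v p} = p" if "p < t" for p using that by simp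
    have "G = {a \<in> el v ` {..<t}. ok (card {b \<in> v. b < a})}" using el_image[OF v'(1)] v'(2) by (simp add: G_def)
    also have "\<dots> = el v ` {p. p < t \<and> ok p}" using rk by auto
    finally show ?thesis .
  qed
  moreover have "inj_on (el v) {p. p < t \<and> ok p}" using inj_on_el[OF v'(1)] v'(2) by (auto intro: inj_on_subset)
  ultimately have "card G = card {p. p < t \<and> ok p}" by (simp add: card_image)
  then have cG: "card G \<ge> n * (k - 1)" using card_ok by simp
  have finG: "finite G" using v' by (simp add: G_def)
  have "card {\<sigma>. \<sigma> permutes {..<N} \<and> v \<in> indep_wins N \<sigma>} * t = (\<Sum>a\<in>G. card (D a) * t)"
    unfolding eq using card_UN_disjoint[of G D] finG finD disj by (simp add: sum_distrib_right)
  also have "\<dots> = (\<Sum>a\<in>G. fact N)"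
    using card_permutations_max_at[OF v'(3)] v'(2) by (intro sum.cong) (auto simp: D_def G_def)
  also have "\<dots> = card G * fact N" by simp
  also have "\<dots> \<ge> n * (k - 1) * fact N" using cG by simp
  finally show ?thesis .
qed

text \<open>First moment argument: some permutation reaches the average weight of
  \<open>indep_wins\<close> over all permutations.\<close>

lemma weighted_indep:
  fixes w :: "nat set \<Rightarrow> real"
  assumes w: "\<And>v. w v \<ge> 0" and \<mu>: "\<mu> * real t \<le> real (n * (k - 1))"
  shows "\<exists>\<sigma>. \<sigma> permutes {..<N} \<and> sum w (indep_wins N \<sigma>) \<ge> \<mu> * sum w (nsets {..<N} t)"
proof (rule ccontr)
  assume no: "\<not> ?thesis"
  let ?V = "nsets {..<N} t" and ?P = "{\<sigma>. \<sigma> permutes {..<N}}"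
  have finV: "finite ?V" by (simp add: finite_imp_finite_nsets)
  have finP: "finite ?P" by (simp add: finite_permutations)
  have cardP: "card ?P = fact N" by (simp add: card_permutations[OF refl])
  have t0: "t > 0" using sm k3 by linarith
  have sum_indep: "sum w (indep_wins N \<sigma>) = (\<Sum>v\<in>?V. if v \<in> indep_wins N \<sigma> then w v else 0)" for \<sigma>
  proof -
    have "?V \<inter> {v. v \<in> indep_wins N \<sigma>} = indep_wins N \<sigma>" by (auto simp: indep_wins_def)
    then show ?thesis using sum.If_cases[OF finV, of "\<lambda>v. v \<in> indep_wins N \<sigma>" w "\<lambda>_. 0"] by simp
  qed
  have "(\<Sum>\<sigma>\<in>?P. sum w (indep_wins N \<sigma>)) = (\<Sum>v\<in>?V. \<Sum>\<sigma>\<in>?P. if v \<in> indep_wins N \<sigma> then w v else 0)"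
    unfolding sum_indep by (rule sum.swap)
  also have "\<dots> = (\<Sum>v\<in>?V. real (card {\<sigma>. \<sigma> permutes {..<N} \<and> v \<in> indep_wins N \<sigma>}) * w v)"
  proof (rule sum.cong[OF refl])
    fix v
    have "?P \<inter> {\<sigma>. v \<in> indep_wins N \<sigma>} = {\<sigma>. \<sigma> permutes {..<N} \<and> v \<in> indep_wins N \<sigma>}" by auto
    then show "(\<Sum>\<sigma>\<in>?P. if v \<in> indep_wins N \<sigma> then w v else 0) = real (card {\<sigma>. \<sigma> permutes {..<N} \<and> v \<in> indep_wins N \<sigma>}) * w v"
      using sum.If_cases[OF finP, of "\<lambda>\<sigma>. v \<in> indep_wins N \<sigma>" "\<lambda>_. w v" "\<lambda>_. 0"] by simp
  qed
  also have "\<dots> \<ge> (\<Sum>v\<in>?V. (\<mu> * fact N) * w v)"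
  proof (intro sum_mono mult_right_mono w)
    fix v assume v: "v \<in> ?V"
    have "\<mu> * fact N * t \<le> real (n * (k - 1)) * fact N"
      using mult_right_mono[OF \<mu>, of "fact N"] by (simp add: algebra_simps)
    also have "\<dots> \<le> real (card {\<sigma>. \<sigma> permutes {..<N} \<and> v \<in> indep_wins N \<sigma>} * t)"
      using card_permutations_indep[OF v] by (metis of_nat_fact of_nat_le_iff of_nat_mult)
    finally show "\<mu> * fact N \<le> real (card {\<sigma>. \<sigma> permutes {..<N} \<and> v \<in> indep_wins N \<sigma>})"
      using t0 by simp
  qed
  finally have "fact N * (\<mu> * sum w ?V) \<le> (\<Sum>\<sigma>\<in>?P. sum w (indep_wins N \<sigma>))"
    by (simp add: sum_distrib_left algebra_simps)
  moreover have "(\<Sum>\<sigma>\<in>?P. sum w (indep_wins N \<sigma>)) < (\<Sum>\<sigma>\<in>?P. \<mu> * sum w ?V)"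
    using no finP permutes_id[of "{..<N}"] by (intro sum_strict_mono) (auto simp: not_le intro: exI[of _ id])
  ultimately show False using cardP by simp
qed

end

text \<open>Independence is weighted because the weights will be the sizes of the fibres of an
  arbitrary set under the projection.\<close>

lemma linear_hypergraph_exists:
  fixes k r :: nat and \<mu> :: real
  assumes k: "k \<ge> 3" and \<mu>: "0 < \<mu>" "\<mu> < (real k - 1) / real k"
  shows "\<exists>(V :: nat set set) E. finite V \<and>
    (\<forall>e\<in>E. e \<subseteq> V \<and> card e = k) \<and>
    (\<forall>e\<in>E. \<forall>e'\<in>E. \<forall>u w. u \<noteq> w \<longrightarrow> {u, w} \<subseteq> e \<longrightarrow> {u, w} \<subseteq> e' \<longrightarrow> e = e') \<and>
    (\<forall>c :: nat set \<Rightarrow> nat. (\<forall>v\<in>V. c v < r) \<longrightarrow> (\<exists>e\<in>E. \<exists>col. \<forall>v\<in>e. c v = col)) \<and>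
    (\<forall>w :: nat set \<Rightarrow> real. (\<forall>v. w v \<ge> 0) \<longrightarrow>
      (\<exists>I\<subseteq>V. (\<forall>e\<in>E. \<not> e \<subseteq> I) \<and> sum w I \<ge> \<mu> * sum w V))"
proof -
  have pos: "real k - 1 - \<mu> * k > 0" using \<mu>(2) k by (simp add: field_simps)
  \<comment> \<open>Rearranged, this is \<open>\<mu> * (2 * s + k * n) < n * (k - 1)\<close>, the
    density bound that \<open>weighted_indep\<close> asks for.\<close>
  obtain n :: nat where n: "2 * \<mu> * (k * k) / (real k - 1 - \<mu> * k) < n" using reals_Archimedean2 by blast
  interpret window_hypergraph k n by unfold_locales (rule k)
  have "2 * \<mu> * (k * k) < n * (real k - 1 - \<mu> * k)" using n pos by (simp add: field_simps)
  then have \<mu>t: "\<mu> * real t \<le> real (n * (k - 1))"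
    using k by (simp add: t_def s_def of_nat_diff algebra_simps)
  \<comment> \<open>Ramsey for \<open>t\<close>-sets: some \<open>m\<close>-set has all its
    \<open>t\<close>-subsets, hence all its windows, in one colour.\<close>
  obtain N where N: "partn_lst {..<N::nat} (replicate r m) t" using ramsey_full by blast
  define V where "V = nsets {..<N} t"
  define E where "E = edge ` nsets {..<N} m"
  show ?thesis
  proof (rule exI[of _ V], rule exI[of _ E], intro conjI ballI allI impI)
    show "finite V" by (simp add: V_def finite_imp_finite_nsets)
    show "e \<subseteq> V" "card e = k" if "e \<in> E" for e
      using that win_nsets inj_on_win by (auto simp: E_def V_def edge_def card_image)
    show "e = e'" if "e \<in> E" "e' \<in> E" "u \<noteq> w" "{u, w} \<subseteq> e" "{u, w} \<subseteq> e'" for e e' u w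
    proof -
      have "R = u \<union> w" if R: "{u, w} \<subseteq> edge R" "R \<in> nsets {..<N} m" for R
      proof -
        obtain i j where "i < k" "u = win R i" "j < k" "w = win R j" using R(1) by (auto simp: edge_def)
        then show ?thesis using win_Un[OF R(2), of i j] \<open>u \<noteq> w\<close> by auto
      qed
      then show ?thesis using that by (auto simp: E_def)
    qed
    show "\<exists>e\<in>E. \<exists>col. \<forall>v\<in>e. c v = col" if c: "\<forall>v\<in>V. c v < r" for c :: "nat set \<Rightarrow> nat"
    proof -
      have "c \<in> nsets {..<N} t \<rightarrow> {..<r}" using c by (auto simp: V_def)
      then obtain i H where iH: "i < r" "H \<in> nsets {..<N} m" "c ` nsets H t \<subseteq> {i}"
        using N unfolding partn_lst_def monochromatic_def by fastforce
      have "H \<in> nsets H m" using iH(2) by (simp add: nsets_def)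
      then have "edge H \<subseteq> nsets H t" using win_nsets by (auto simp: edge_def)
      then have "\<forall>v\<in>edge H. c v = i" using iH(3) by blast
      then show ?thesis using iH by (auto simp: E_def)
    qed
    show "\<exists>I\<subseteq>V. (\<forall>e\<in>E. \<not> e \<subseteq> I) \<and> sum w I \<ge> \<mu> * sum w V" if w: "\<forall>v. w v \<ge> 0" for w :: "nat set \<Rightarrow> real"
    proof -
      obtain \<sigma> where \<sigma>: "\<sigma> permutes {..<N}" "sum w (indep_wins N \<sigma>) \<ge> \<mu> * sum w V"
        using weighted_indep[of w \<mu> N] w \<mu>t unfolding V_def by blast
      then show ?thesis using edge_not_subset_indep[OF _ permutes_inj]
        by (intro exI[of _ "indep_wins N \<sigma>"]) (auto simp: E_def V_def indep_wins_def)
    qed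
  qed
qed

section \<open>Arithmetic progressions and the partite construction\<close>

lemma is_AP_eq_image: "is_AP k S \<longleftrightarrow> (\<exists>a d. d > 0 \<and> S = (\<lambda>i. a + i * d) ` {..<k})"
  unfolding is_AP_def by (simp add: setcompr_eq_image lessThan_def)

lemma is_AP_affine_image:
  assumes "is_AP k S" "b > 0"
  shows "is_AP k ((\<lambda>y. a + b * y) ` S)"
proof -
  obtain a' d where "d > 0" "S = (\<lambda>i. a' + i * d) ` {..<k}" using assms by (auto simp: is_AP_eq_image)
  then have "(\<lambda>y. a + b * y) ` S = (\<lambda>i. (a + b * a') + i * (b * d)) ` {..<k}"
    by (auto simp: image_image algebra_simps)
  then show ?thesis unfolding is_AP_eq_image using \<open>d > 0\<close> assms(2) by (metis mult_pos_pos)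
qed

lemma card_is_AP: "is_AP k S \<Longrightarrow> card S = k"
  by (auto simp: is_AP_eq_image card_image inj_on_def)

text \<open>A decreasing sequence also gives a progression, since only the set of values counts.
  This is what permits opposite directions in different digits later on.\<close>

lemma const_or_is_AP:
  fixes g :: "nat \<Rightarrow> nat"
  assumes k: "k \<ge> 2" and g: "\<And>j. j + 2 < k \<Longrightarrow> g j + g (j + 2) = 2 * g (j + 1)"
  shows "(\<forall>j<k. g j = g 0) \<or> is_AP k (g ` {..<k})"
proof -
  have lin: "int (g j) = int (g 0) + int j * (int (g 1) - int (g 0))" if "j < k" for j
    using that
  proof (induction j rule: less_induct)
    case (less j)
    show ?case
    proof (cases "j < 2")
      case True
      then have "j = 0 \<or> j = 1" by auto
      then show ?thesis by auto
    next
      case False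
      then obtain i where i: "j = i + 2" by (metis add.commute le_Suc_ex not_less)
      have "int (g i) + int (g (i + 2)) = 2 * int (g (i + 1))"
        using g[of i] less.prems i by linarith
      then show ?thesis using less.IH[of i] less.IH[of "i + 1"] less.prems i by (simp add: algebra_simps)
    qed
  qed
  consider "g 1 = g 0" | "g 0 < g 1" | "g 1 < g 0" by linarith
  then show ?thesis
  proof cases
    case 1
    have "g j = g 0" if "j < k" for j using lin[OF that] 1 by simp
    then show ?thesis by blast
  next
    case 2
    have *: "g j = g 0 + j * (g 1 - g 0)" if "j < k" for j
    proof -
      have "int (g j) = int (g 0 + j * (g 1 - g 0))" using lin[OF that] 2 by (simp add: of_nat_diff)
      then show ?thesis by linarith
    qed
    have "g ` {..<k} = (\<lambda>i. g 0 + i * (g 1 - g 0)) ` {..<k}"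
      by (rule image_cong[OF refl], rule *) simp
    moreover have "g 1 - g 0 > 0" using 2 by simp
    ultimately show ?thesis unfolding is_AP_eq_image by blast
  next
    case 3
    let ?d = "g 0 - g 1"
    have *: "g (k - 1 - j) = g (k - 1) + j * ?d" if "j < k" for j
    proof -
      have "int (g (k - 1 - j)) = int (g (k - 1)) + int j * int ?d"
        using lin[of "k - 1 - j"] lin[of "k - 1"] that k 3 by (simp add: of_nat_diff algebra_simps)
      then show ?thesis by (metis of_nat_add of_nat_eq_iff of_nat_mult)
    qed
    have "g ` {..<k} = (\<lambda>j. g (k - 1 - j)) ` {..<k}"
    proof (intro equalityI subsetI)
      fix x assume "x \<in> g ` {..<k}"
      then obtain j where "j < k" "x = g j" by auto
      then have "x = g (k - 1 - (k - 1 - j))" "k - 1 - j < k" by auto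
      then show "x \<in> (\<lambda>j. g (k - 1 - j)) ` {..<k}" by blast
    qed auto
    also have "\<dots> = (\<lambda>j. g (k - 1) + j * ?d) ` {..<k}"
      by (rule image_cong[OF refl], rule *) simp
    finally have "g ` {..<k} = (\<lambda>j. g (k - 1) + j * ?d) ` {..<k}" .
    moreover have "?d > 0" using 3 by simp
    ultimately show ?thesis unfolding is_AP_eq_image by blast
  qed
qed

text \<open>Each block starts beyond twice the end of the previous ones, plus a margin
  \<open>c\<close>. As \<open>k \<ge> 3\<close>, the last but one term \<open>y\<close> is at least
  \<open>d\<close>, so the last term \<open>y + d\<close> is at most twice \<open>y\<close> and lies
  in the same block. Then \<open>d\<close> is at most the width \<open>b j\<close>, and no term can
  fall below the margin \<open>c j = k * b j\<close>.\<close>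

lemma separated_translates:
  fixes F :: "nat \<Rightarrow> nat set"
  assumes F: "\<And>i. finite (F i)" and k: "k \<ge> 3"
  shows "\<exists>N. (\<forall>S. S \<subseteq> (\<Union>i. (+) (N i) ` F i) \<longrightarrow> is_AP k S \<longrightarrow> (\<exists>i. S \<subseteq> (+) (N i) ` F i)) \<and>
    (\<forall>i j. i \<noteq> j \<longrightarrow> (+) (N i) ` F i \<inter> (+) (N j) ` F j = {})"
proof -
  have "\<exists>b. \<forall>x\<in>F i. x \<le> b" for i using F[of i] by (meson finite_nat_set_iff_bounded_le)
  then obtain b where b: "\<And>i x. x \<in> F i \<Longrightarrow> x \<le> b i" by metis
  define c where "c i = k * b i" for i
  define N where "N = rec_nat 0 (\<lambda>i Ni. 2 * (Ni + b i) + c (Suc i) + 1)"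
  have NS: "N (Suc i) = 2 * (N i + b i) + c (Suc i) + 1" for i by (simp add: N_def)
  have mono: "i \<le> j \<Longrightarrow> N i + b i \<le> N j + b j" for i j
  proof (induction rule: dec_induct)
    case (step j)
    have "N i + b i \<le> N j + b j" by (rule step.IH)
    also have "\<dots> \<le> N (Suc j) + b (Suc j)" by (simp add: NS)
    finally show ?case .
  qed simp
  have gap: "N j > 2 * (N i + b i) + c j" if ij: "i < j" for i j
  proof -
    obtain j' where j': "j = Suc j'" using ij by (cases j) auto
    then show ?thesis using NS[of j'] mono[of i j'] ij by simp
  qed
  have block: "N i \<le> x \<and> x \<le> N i + b i" if "x \<in> (+) (N i) ` F i" for i x using that b by auto
  have uniq: "i = j" if "x \<in> (+) (N i) ` F i" "x \<in> (+) (N j) ` F j" for i j x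
    using block[OF that(1)] block[OF that(2)] gap[of i j] gap[of j i] by (cases i j rule: linorder_cases) auto
  show ?thesis
  proof (intro exI[of _ N] conjI allI impI)
    show "(+) (N i) ` F i \<inter> (+) (N j) ` F j = {}" if "i \<noteq> j" for i j using that uniq by blast
    show "\<exists>i. S \<subseteq> (+) (N i) ` F i" if S: "S \<subseteq> (\<Union>i. (+) (N i) ` F i)" "is_AP k S" for S
    proof -
      obtain a d where ad: "d > 0" "S = (\<lambda>i. a + i * d) ` {..<k}" using S(2) by (auto simp: is_AP_eq_image)
      define y where "y = a + (k - 2) * d"
      obtain q0 where q0: "k = q0 + 3" using k by (metis add.commute le_Suc_ex)
      then have kd: "(k - 2) * d + d = (k - 1) * d" by simp
      have xy: "y + d \<in> S" "y \<in> S"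
      proof -
        have "y + d = a + (k - 1) * d" using kd by (simp add: y_def)
        then show "y + d \<in> S" unfolding ad(2) using k by (intro image_eqI[of _ _ "k - 1"]) auto
        show "y \<in> S" unfolding ad(2) y_def using k by (intro image_eqI[of _ _ "k - 2"]) auto
      qed
      have yd: "y \<ge> d" using q0 by (simp add: y_def)
      obtain j where j: "y + d \<in> (+) (N j) ` F j" using xy S(1) by blast
      obtain i where i: "y \<in> (+) (N i) ` F i" using xy S(1) by blast
      have ij: "i = j"
        using block[OF i] block[OF j] gap[of i j] gap[of j i] yd by (cases i j rule: linorder_cases) auto
      have d: "d \<le> b j" using block[OF i] block[OF j] ij by simp
      have "z \<in> (+) (N j) ` F j" if "z \<in> S" for z
      proof -
        obtain q where q: "q < k" "z = a + q * d" using \<open>z \<in> S\<close> ad by auto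
        obtain l where l: "z \<in> (+) (N l) ` F l" using \<open>z \<in> S\<close> S(1) by blast
        have "q * d \<le> (k - 1) * d" using q by (intro mult_right_mono) auto
        then have up: "z \<le> y + d" using q kd by (simp add: y_def)
        have "(k - 2) * d + d \<le> k * b j"
          unfolding kd using d by (intro mult_mono) auto
        then have lo: "y + d \<le> z + c j" using q by (simp add: y_def c_def)
        have "l = j"
          using block[OF l] block[OF j] gap[of l j] gap[of j l] up lo by (cases l j rule: linorder_cases) auto
        then show ?thesis using l by simp
      qed
      then show ?thesis by blast
    qed
  qed
qed

section \<open>Words as integers in a large base\<close>

primrec enc :: "nat \<Rightarrow> nat list \<Rightarrow> nat" where
  "enc B [] = 0"
| "enc B (x # xs) = x + B * enc B xs"

text \<open>Digits below half the base produce no carries, so the midpoint equation holds digit by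
  digit.\<close>

lemma enc_midpoint:
  assumes "length xs = length ys" "length ys = length zs"
    and "\<forall>x\<in>set xs \<union> set ys \<union> set zs. 2 * x < B" and "enc B xs + enc B zs = 2 * enc B ys"
    and "i < length xs"
  shows "xs ! i + zs ! i = 2 * ys ! i"
  using assms
proof (induction xs ys zs arbitrary: i rule: list_induct3)
  case (Cons x xs y ys z zs)
  let ?X = "enc B xs + enc B zs" and ?Y = "2 * enc B ys"
  have eq: "x + z + B * ?X = 2 * y + B * ?Y" using Cons.prems(2) by (simp add: algebra_simps)
  have lt: "x + z < B" "2 * y < B" using Cons.prems(1) by auto
  have "(x + z + B * ?X) mod B = (2 * y + B * ?Y) mod B" "(x + z + B * ?X) div B = (2 * y + B * ?Y) div B"
    using eq by auto
  then have "x + z = 2 * y" "?X = ?Y" using lt by auto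
  then show ?case using Cons by (cases i) auto
qed simp

lemma enc_inj:
  assumes "length xs = length ys" "\<forall>x\<in>set xs \<union> set ys. 2 * x < B" "enc B xs = enc B ys"
  shows "xs = ys"
proof (rule nth_equalityI)
  fix i assume "i < length xs"
  moreover have "enc B xs + enc B xs = 2 * enc B ys" using assms(3) by simp
  ultimately have "xs ! i + xs ! i = 2 * ys ! i"
    using enc_midpoint[OF assms(1) assms(1)[symmetric]] assms(2) by blast
  then show "xs ! i = ys ! i" by simp
qed (rule assms)

text \<open>The slope is the sum of the powers of \<open>B\<close> at the active positions. Thus a
  line becomes an affine copy of its alphabet.\<close>

lemma enc_fill_affine:
  assumes "B > 0"
  shows "\<exists>a b. (None \<in> set l \<longrightarrow> b > 0) \<and> (\<forall>y. enc B (fill l y) = a + b * y)"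
proof (induction l)
  case Nil
  show ?case by (simp add: fill_def)
next
  case (Cons o' l)
  then obtain a b where ab: "None \<in> set l \<longrightarrow> b > 0" "\<And>y. enc B (fill l y) = a + b * y" by blast
  show ?case
  proof (cases o')
    case None
    have "enc B (fill (o' # l) y) = B * a + (1 + B * b) * y" for y
      using ab(2) None by (simp add: fill_def algebra_simps)
    then show ?thesis by (metis add_gr_0 zero_less_one)
  next
    case (Some x)
    have "enc B (fill (o' # l) y) = (x + B * a) + (B * b) * y" for y
      using ab(2) Some by (simp add: fill_def algebra_simps)
    moreover have "None \<in> set (o' # l) \<longrightarrow> B * b > 0" using ab(1) Some assms by auto
    ultimately show ?thesis by metis
  qed
qed

section \<open>Partite systems over a linear hypergraph\<close>

locale linear_hypergraph =
  fixes k :: nat and V :: "'v set" and E :: "'v set set"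
  assumes k3: "k \<ge> 3"
    and edges: "\<And>e. e \<in> E \<Longrightarrow> e \<subseteq> V \<and> card e = k"
    and linear: "\<And>e e' u w. \<lbrakk>e \<in> E; e' \<in> E; u \<noteq> w; {u, w} \<subseteq> e; {u, w} \<subseteq> e'\<rbrakk> \<Longrightarrow> e = e'"
begin

definition faithful :: "nat set \<Rightarrow> (nat \<Rightarrow> 'v) \<Rightarrow> bool" where
  "faithful P \<pi> \<longleftrightarrow> finite P \<and> \<pi> ` P \<subseteq> V \<and> (\<forall>S\<subseteq>P. is_AP k S \<longrightarrow> \<pi> ` S \<in> E)"

text \<open>If the projection were not an edge, every non-constant coordinate \<open>i\<close> would have a unique index \<open>j\<close>
  at which the fibre element sits at an inactive position. Linearity forces exactly two such indices
  \<open>j0, j1\<close> to occur, and then the active set of any third line is the disjoint union of those of \<open>l j0\<close> and \<open>l j1\<close>.\<close>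

lemma line_points_project_to_edge:
  fixes y :: "nat \<Rightarrow> nat" and l :: "nat \<Rightarrow> nat option list"
  assumes P: "faithful P \<pi>" and L: "schur_free L"
    and Lf: "\<And>l. l \<in> L \<Longrightarrow> length l = n \<and> None \<in> set l \<and> set l \<subseteq> insert None (Some ` {x\<in>P. \<pi> x = v})"
    and l: "\<And>j. j < k \<Longrightarrow> l j \<in> L" and y: "\<And>j. j < k \<Longrightarrow> y j \<in> P"
    and mid: "\<And>i j. i < n \<Longrightarrow> j + 2 < k \<Longrightarrow>
       fill (l j) (y j) ! i + fill (l (j + 2)) (y (j + 2)) ! i = 2 * fill (l (j + 1)) (y (j + 1)) ! i"
    and nonconst: "fill (l 0) (y 0) \<noteq> fill (l 1) (y 1)"
  shows "(\<lambda>j. \<pi> (y j)) ` {..<k} \<in> E"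
proof (rule ccontr)
  assume notE: "\<not> ?thesis"
  define g where "g i j = fill (l j) (y j) ! i" for i j
  \<comment> \<open>In these coordinates the digits form a genuine progression, so they project
    bijectively onto an edge.\<close>
  define act where "act i \<longleftrightarrow> i < n \<and> \<not> (\<forall>j<k. g i j = g i 0)" for i
  have len: "length (l j) = n" if "j < k" for j using Lf l that by blast
  have gN: "g i j = y j" if "l j ! i = None" "i < n" "j < k" for i j
    using that len by (simp add: g_def fill_def)
  have gS: "g i j \<in> P \<and> \<pi> (g i j) = v" if ij: "l j ! i \<noteq> None" "i < n" "j < k" for i j
  proof -
    have "l j ! i \<in> set (l j)" using ij len by simp
    then obtain x where "l j ! i = Some x" "x \<in> P" "\<pi> x = v" using Lf[OF l[OF ij(3)]] ij(1) by auto
    then show ?thesis using ij len by (simp add: g_def fill_def)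
  qed
  have gP: "g i j \<in> P" if "i < n" "j < k" for i j using gN gS y that by metis
  have actE: "(\<lambda>j. \<pi> (g i j)) ` {..<k} \<in> E" if "act i" for i
  proof -
    have i: "i < n" using that by (simp add: act_def)
    have "is_AP k (g i ` {..<k})"
      using const_or_is_AP[of k "g i"] k3 mid[OF i] that by (auto simp: g_def act_def)
    moreover have "g i ` {..<k} \<subseteq> P" using gP i by auto
    ultimately have "\<pi> ` g i ` {..<k} \<in> E" using P by (auto simp: faithful_def)
    then show ?thesis by (simp add: image_image)
  qed
  have inj: "j = j'" if "act i" "j < k" "j' < k" "\<pi> (g i j) = \<pi> (g i j')" for i j j'
  proof -
    have "card ((\<lambda>j. \<pi> (g i j)) ` {..<k}) = card {..<k}" using edges[OF actE[OF that(1)]] by simp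
    then have "inj_on (\<lambda>j. \<pi> (g i j)) {..<k}" by (intro eq_card_imp_inj_on) auto
    then show ?thesis using that by (auto dest: inj_onD)
  qed
  \<comment> \<open>Otherwise replacing \<open>y j\<close> by a fibre letter never changes the
    projection, and the edge seen in coordinate \<open>i\<close> is the projection of the points
    \<open>y j\<close> themselves.\<close>
  have defect: "\<exists>j<k. l j ! i \<noteq> None \<and> \<pi> (y j) \<noteq> v" if "act i" for i
  proof (rule ccontr)
    assume no: "\<not> ?thesis"
    have i: "i < n" using that by (simp add: act_def)
    have "\<pi> (g i j) = \<pi> (y j)" if "j < k" for j using no gN[of j i] gS[of j i] i that by metis
    then have "(\<lambda>j. \<pi> (g i j)) ` {..<k} = (\<lambda>j. \<pi> (y j)) ` {..<k}" by (intro image_cong) auto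
    then show False using actE[OF that] notE by simp
  qed
  have others: "l j' ! i = None" "\<pi> (y j') \<noteq> v"
    if "act i" "j < k" "l j ! i \<noteq> None" "j' < k" "j' \<noteq> j" for i j j'
  proof -
    have i: "i < n" using that by (simp add: act_def)
    have "\<pi> (g i j') \<noteq> v" using inj[of i j j'] gS[OF that(3) i that(2)] that by metis
    then show "l j' ! i = None" "\<pi> (y j') \<noteq> v" using gS[of j' i] gN[of j' i] i that by metis+
  qed
  obtain i0 where i0: "act i0"
  proof -
    have "length (fill (l 0) (y 0)) = n" "length (fill (l 1) (y 1)) = n" using len k3 by (auto simp: fill_def)
    then obtain i where "i < n" "g i 0 \<noteq> g i 1" using nonconst by (metis g_def nth_equalityI)
    then show thesis using that[of i] k3 unfolding act_def by (metis One_nat_def Suc_1 Suc_le_lessD Suc_lessD eval_nat_numeral(3))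
  qed
  obtain j0 where j0: "j0 < k" "l j0 ! i0 \<noteq> None" "\<pi> (y j0) \<noteq> v" using defect[OF i0] by blast
  have yv: "\<pi> (y j) \<noteq> v" if "j < k" for j using others(2)[OF i0 j0(1,2) that] j0 by metis
  have i0n: "i0 < n" using i0 by (simp add: act_def)
  \<comment> \<open>An active position in a constant coordinate would show a value outside the
    fibre, forcing all \<open>y j\<close> to be equal, against injectivity in coordinate
    \<open>i0\<close>.\<close>
  have inact: "l j ! i \<noteq> None" if i: "i < n" "\<not> act i" and j: "j < k" for i j
  proof
    assume N: "l j ! i = None"
    have const: "g i j' = y j" if "j' < k" for j'
      using i j that gN[OF N i(1) j] by (metis act_def)
    have yy: "y j' = y j" if "j' < k" for j'
    proof -
      have "l j' ! i = None" using gS[OF _ i(1) that] const[OF that] yv[OF j] by metis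
      then show ?thesis using gN[OF _ i(1) that] const[OF that] by metis
    qed
    obtain a b where ab: "a < k" "b < k" "a \<noteq> b" "a \<noteq> j0" "b \<noteq> j0"
    proof -
      have "card ({..<k} - {j0}) \<ge> 2" using k3 j0 by simp
      then obtain T where "T \<subseteq> {..<k} - {j0}" "card T = 2" using obtain_subset_with_card_n by metis
      then show thesis using that by (auto simp: card_2_iff)
    qed
    have "g i0 a = y a" "g i0 b = y b"
      using gN[OF others(1)[OF i0 j0(1,2)] i0n] ab by auto
    then show False using inj[OF i0 ab(1,2)] yy ab by metis
  qed
  have "None \<in> set (l j0)" using Lf l j0 by blast
  then obtain i1 where i1: "i1 < n" "l j0 ! i1 = None" using len[OF j0(1)] by (auto simp: in_set_conv_nth)
  have a1: "act i1" using inact[OF i1(1) _ j0(1)] i1 by blast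
  obtain j1 where j1: "j1 < k" "l j1 ! i1 \<noteq> None" using defect[OF a1] by blast
  have j01: "j0 \<noteq> j1" using i1 j1 by auto
  have "card ({..<k} - {j0, j1}) > 0" using k3 j0 j1 j01 by (simp add: card_Diff_subset)
  then obtain j2 where j2: "j2 < k" "j2 \<noteq> j0" "j2 \<noteq> j1" by (auto simp: card_gt_0_iff)
  \<comment> \<open>Both edges contain \<open>v\<close>, at \<open>j0\<close> and \<open>j1\<close>
    respectively, and the vertex of the common third index \<open>j2\<close>; linearity identifies
    them.\<close>
  have e01: "(\<lambda>j. \<pi> (g i0 j)) ` {..<k} = (\<lambda>j. \<pi> (g i1 j)) ` {..<k}"
  proof (rule linear[OF actE[OF i0] actE[OF a1]])
    show "v \<noteq> \<pi> (y j2)" using yv j2 by metis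
    have "\<pi> (g i0 j0) = v" "\<pi> (g i1 j1) = v" using gS j0 j1 i0n i1 by auto
    moreover have "g i0 j2 = y j2" "g i1 j2 = y j2"
      using gN[OF others(1)[OF i0 j0(1,2)] i0n] gN[OF others(1)[OF a1 j1(1,2)] i1(1)] j2 by auto
    ultimately show "{v, \<pi> (y j2)} \<subseteq> (\<lambda>j. \<pi> (g i0 j)) ` {..<k}" "{v, \<pi> (y j2)} \<subseteq> (\<lambda>j. \<pi> (g i1 j)) ` {..<k}"
      using j0 j1 j2 by (auto intro: rev_image_eqI)
  qed
  \<comment> \<open>The edges agree as sets, and outside \<open>{j0, j1}\<close> they agree index by
    index; the vertices left over must coincide.\<close>
  have same: "\<pi> (y j0) = \<pi> (y j1)"
  proof -
    have gj1: "g i0 j1 = y j1" using gN[OF others(1)[OF i0 j0(1,2)] i0n] j1 j01 by auto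
    then have "\<pi> (y j1) \<in> (\<lambda>j. \<pi> (g i1 j)) ` {..<k}" using e01 j1(1) by force
    then obtain j where j: "j < k" "\<pi> (y j1) = \<pi> (g i1 j)" by auto
    have "j \<noteq> j1" using j gS[OF j1(2) i1(1) j1(1)] yv[OF j1(1)] by metis
    then have gj: "g i1 j = y j" using gN[OF others(1)[OF a1 j1(1,2)] i1(1)] j by auto
    have "j = j0"
    proof (rule ccontr)
      assume "j \<noteq> j0"
      then have "g i0 j = y j" using gN[OF others(1)[OF i0 j0(1,2)] i0n] j by auto
      then show False using inj[OF i0 j(1) j1(1)] gj gj1 j \<open>j \<noteq> j1\<close> by metis
    qed
    then show ?thesis using j gj by simp
  qed
  have "\<forall>i<length (l j2). (l j2 ! i = None \<longleftrightarrow> l j0 ! i = None \<or> l j1 ! i = None) \<and> \<not> (l j0 ! i = None \<and> l j1 ! i = None)"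
  proof (intro allI impI)
    fix i assume "i < length (l j2)"
    then have i: "i < n" using len j2 by simp
    show "(l j2 ! i = None \<longleftrightarrow> l j0 ! i = None \<or> l j1 ! i = None) \<and> \<not> (l j0 ! i = None \<and> l j1 ! i = None)"
    proof (cases "act i")
      case False
      show ?thesis
        using inact[OF i False j0(1)] inact[OF i False j1(1)] inact[OF i False j2(1)] by blast
    next
      case True
      obtain j where j: "j < k" "l j ! i \<noteq> None" using defect[OF True] by blast
      have "j = j0 \<or> j = j1"
      proof (rule ccontr)
        assume "\<not> ?thesis"
        then have "g i j0 = y j0" "g i j1 = y j1"
          using gN[OF others(1)[OF True j] i] j0(1) j1(1) by auto
        then show False using inj[OF True j0(1) j1(1)] same j01 by simp
      qed
      then show ?thesis using others(1)[OF True j] j j0(1) j1(1) j2 j01 by metis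
    qed
  qed
  then show False using L l[OF j0(1)] l[OF j1(1)] l[OF j2(1)] unfolding schur_free_def by blast
qed

text \<open>Each line over the fibre of \<open>v\<close> extends to all letters of \<open>P\<close>
  and encodes an affine copy of \<open>P\<close>; \<open>P'\<close> is the union of these copies. A
  line on which the colour is constant makes the fibre of its copy monochromatic.\<close>

lemma partite_amalgamation:
  assumes P: "faithful P \<pi>" and r: "r \<ge> 1"
  shows "\<exists>P' \<pi>'. faithful P' \<pi>' \<and> (\<forall>c :: nat \<Rightarrow> nat. (\<forall>x\<in>P'. c x < r) \<longrightarrow>
     (\<exists>a b. b > 0 \<and> (\<forall>y\<in>P. a + b * y \<in> P' \<and> \<pi>' (a + b * y) = \<pi> y) \<and>
        (\<forall>x\<in>P. \<forall>y\<in>P. \<pi> x = v \<longrightarrow> \<pi> y = v \<longrightarrow> c (a + b * x) = c (a + b * y))))"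
proof (cases "{x\<in>P. \<pi> x = v} = {}")
  case True
  then have nov: "\<forall>x\<in>P. \<pi> x \<noteq> v" by blast
  have "\<exists>a b. b > 0 \<and> (\<forall>y\<in>P. a + b * y \<in> P \<and> \<pi> (a + b * y) = \<pi> y) \<and>
        (\<forall>x\<in>P. \<forall>y\<in>P. \<pi> x = v \<longrightarrow> \<pi> y = v \<longrightarrow> c (a + b * x) = c (a + b * y))" for c :: "nat \<Rightarrow> nat"
    by (rule exI[of _ 0], rule exI[of _ 1]) (use nov in simp)
  then show ?thesis using P by blast
next
  case False
  let ?X = "{x\<in>P. \<pi> x = v}"
  have finP: "finite P" using P by (simp add: faithful_def)
  obtain n L where L: "line_family ?X n r L" using sparse_Hales_Jewett[of ?X r] False finP by auto
  have Lf: "length l = n \<and> None \<in> set l \<and> set l \<subseteq> insert None (Some ` ?X)" if "l \<in> L" for l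
    using L that by (simp add: line_family_def)
  obtain b where b: "\<And>x. x \<in> P \<Longrightarrow> x \<le> b" using finP by (meson finite_nat_set_iff_bounded_le)
  define B where "B = 2 * b + 1"
  have XP: "?X \<subseteq> P" by blast
  have fill_words: "fill l y \<in> words P n" if "l \<in> L" "y \<in> P" for l y
    using fill_in_words[OF _ XP that(2), of l] Lf[OF that(1)] by auto
  have fill_X: "fill l y \<in> words ?X n" if "l \<in> L" "y \<in> ?X" for l y
    using fill_in_words[OF _ subset_refl that(2), of l] Lf[OF that(1)] by auto
  have small: "2 * x < B" if "w \<in> words P n" "x \<in> set w" for w x
  proof -
    have "x \<le> b" using that b by (auto simp: words_def)
    then show ?thesis by (simp add: B_def)
  qed
  have inj_enc: "inj_on (enc B) (words P n)"
  proof (rule inj_onI)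
    fix w w' assume w: "w \<in> words P n" "w' \<in> words P n" "enc B w = enc B w'"
    then show "w = w'" using enc_inj[of w w' B] small by (auto simp: words_def)
  qed
  define P' where "P' = (\<lambda>(l, y). enc B (fill l y)) ` (L \<times> P)"
  have finP': "finite P'"
  proof -
    have "finite (words P n)" by (rule finite_words[OF finP])
    moreover have "P' \<subseteq> enc B ` words P n" using fill_words by (auto simp: P'_def)
    ultimately show ?thesis by (meson finite_imageI finite_subset)
  qed
  \<comment> \<open>Apart from \<open>y\<close>, the word \<open>fill l y\<close> has only fibre
    letters, so a letter outside the fibre can only be \<open>y\<close>. Hence the projection does
    not depend on the line representing a point.\<close>
  define \<rho> where "\<rho> w = (if \<exists>x\<in>set w. \<pi> x \<noteq> v then \<pi> (SOME x. x \<in> set w \<and> \<pi> x \<noteq> v) else v)" for w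
  have \<rho>: "\<rho> (fill l y) = \<pi> y" if "l \<in> L" "y \<in> P" for l y
  proof -
    have y: "y \<in> set (fill l y)" using Lf[OF that(1)] by (force simp: fill_def)
    have other: "x = y \<or> \<pi> x = v" if "x \<in> set (fill l y)" for x
      using that Lf[OF \<open>l \<in> L\<close>] by (fastforce simp: fill_def split: option.splits)
    show ?thesis
    proof (cases "\<pi> y = v")
      case True
      then show ?thesis using other by (auto simp: \<rho>_def)
    next
      case False
      then have "(SOME x. x \<in> set (fill l y) \<and> \<pi> x \<noteq> v) = y" using y other by (intro some_equality) auto
      then show ?thesis using False y by (auto simp: \<rho>_def)
    qed
  qed
  define \<pi>' where "\<pi>' z = \<rho> (inv_into (words P n) (enc B) z)" for z
  have \<pi>': "\<pi>' (enc B (fill l y)) = \<pi> y" if "l \<in> L" "y \<in> P" for l y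
    unfolding \<pi>'_def using inv_into_f_f[OF inj_enc fill_words[OF that]] \<rho>[OF that] by simp
  have "faithful P' \<pi>'"
    unfolding faithful_def
  proof (intro conjI allI impI)
    show "finite P'" by (rule finP')
    show "\<pi>' ` P' \<subseteq> V" using \<pi>' P by (auto simp: P'_def faithful_def)
    fix S assume S: "S \<subseteq> P'" "is_AP k S"
    obtain a d where ad: "d > 0" "S = (\<lambda>i. a + i * d) ` {..<k}" using S(2) by (auto simp: is_AP_eq_image)
    have "\<exists>l y. l \<in> L \<and> y \<in> P \<and> a + j * d = enc B (fill l y)" if "j < k" for j
      using S(1) ad that by (force simp: P'_def)
    then obtain l y where ly: "\<And>j. j < k \<Longrightarrow> l j \<in> L \<and> y j \<in> P \<and> a + j * d = enc B (fill (l j) (y j))"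
      by metis
    have w: "fill (l j) (y j) \<in> words P n" if "j < k" for j using fill_words ly that by blast
    have "(\<lambda>j. \<pi> (y j)) ` {..<k} \<in> E"
    proof (rule line_points_project_to_edge[OF P _ Lf, of L l])
      show "schur_free L" using L by (simp add: line_family_def)
      show "fill (l j) (y j) ! i + fill (l (j + 2)) (y (j + 2)) ! i = 2 * fill (l (j + 1)) (y (j + 1)) ! i"
        if "i < n" "j + 2 < k" for i j
      proof (rule enc_midpoint)
        have j: "j < k" "j + 1 < k" using that by auto
        show "length (fill (l j) (y j)) = length (fill (l (j + 1)) (y (j + 1)))"
          "length (fill (l (j + 1)) (y (j + 1))) = length (fill (l (j + 2)) (y (j + 2)))"
          "i < length (fill (l j) (y j))"
          using w[OF j(1)] w[OF j(2)] w[OF that(2)] that(1) by (auto simp: words_def)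
        show "\<forall>x\<in>set (fill (l j) (y j)) \<union> set (fill (l (j + 1)) (y (j + 1))) \<union> set (fill (l (j + 2)) (y (j + 2))). 2 * x < B"
          using small w[OF j(1)] w[OF j(2)] w[OF that(2)] by blast
        show "enc B (fill (l j) (y j)) + enc B (fill (l (j + 2)) (y (j + 2))) = 2 * enc B (fill (l (j + 1)) (y (j + 1)))"
          using ly[OF j(1), THEN conjunct2, THEN conjunct2, symmetric]
            ly[OF j(2), THEN conjunct2, THEN conjunct2, symmetric]
            ly[OF that(2), THEN conjunct2, THEN conjunct2, symmetric] by (simp only:) (simp add: algebra_simps)
      qed
      show "fill (l 0) (y 0) \<noteq> fill (l 1) (y 1)"
      proof
        assume "fill (l 0) (y 0) = fill (l 1) (y 1)"
        then have "a + 0 * d = a + 1 * d" using ly[of 0] ly[of 1] k3 by simp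
        then show False using ad(1) by simp
      qed
    qed (use ly in auto)
    moreover have "\<pi>' ` S = (\<lambda>j. \<pi> (y j)) ` {..<k}"
      unfolding ad(2) image_image using ly \<pi>' by (intro image_cong) auto
    ultimately show "\<pi>' ` S \<in> E" by simp
  qed
  moreover have "\<exists>a b. b > 0 \<and> (\<forall>y\<in>P. a + b * y \<in> P' \<and> \<pi>' (a + b * y) = \<pi> y) \<and>
        (\<forall>x\<in>P. \<forall>y\<in>P. \<pi> x = v \<longrightarrow> \<pi> y = v \<longrightarrow> c (a + b * x) = c (a + b * y))"
    if c: "\<forall>x\<in>P'. c x < r" for c :: "nat \<Rightarrow> nat"
  proof -
    \<comment> \<open>Words over the fibre need not encode points of \<open>P'\<close>; they get the
      colour 0, which is below \<open>r\<close>.\<close>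
    define f where "f w = (if enc B w \<in> P' then c (enc B w) else 0)" for w
    have "f ` words ?X n \<subseteq> {..<r}" using c r by (auto simp: f_def)
    then have "\<exists>l\<in>L. \<forall>x\<in>?X. \<forall>y\<in>?X. f (fill l x) = f (fill l y)"
      using line_family_coloring[OF L, of f "{..<r}"] by simp
    then obtain l where l: "l \<in> L" "\<forall>x\<in>?X. \<forall>y\<in>?X. f (fill l x) = f (fill l y)" by blast
    obtain a b where ab: "b > 0" "\<And>y. enc B (fill l y) = a + b * y"
      using enc_fill_affine[of B l] Lf[OF l(1)] by (auto simp: B_def)
    have inP': "a + b * y \<in> P'" if "y \<in> P" for y
      using ab(2)[of y, symmetric] l(1) that by (auto simp: P'_def)
    moreover have "\<pi>' (a + b * y) = \<pi> y" if "y \<in> P" for y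
      using \<pi>'[OF l(1) that] ab(2) by simp
    moreover have "c (a + b * x) = c (a + b * y)" if "x \<in> ?X" "y \<in> ?X" for x y
    proof -
      have "f (fill l x) = f (fill l y)" using l(2) that by blast
      then show ?thesis using inP'[of x] inP'[of y] that by (simp add: f_def ab(2))
    qed
    ultimately show ?thesis using ab(1) by blast
  qed
  ultimately show ?thesis by blast
qed

text \<open>Amalgamation at the new vertex is applied to the system already built. A colouring is
  first restricted to a copy of \<open>P1\<close>, good for \<open>v\<close>, and then pulled back
  to find a copy of \<open>P\<close> in it; affine maps compose.\<close>

lemma partite_construction:
  assumes "faithful P \<pi>" "finite U" "r \<ge> 1"
  shows "\<exists>P' \<pi>'. faithful P' \<pi>' \<and> (\<forall>c :: nat \<Rightarrow> nat. (\<forall>x\<in>P'. c x < r) \<longrightarrow>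
     (\<exists>a b. b > 0 \<and> (\<forall>y\<in>P. a + b * y \<in> P' \<and> \<pi>' (a + b * y) = \<pi> y) \<and>
        (\<forall>x\<in>P. \<forall>y\<in>P. \<pi> x \<in> U \<longrightarrow> \<pi> y = \<pi> x \<longrightarrow> c (a + b * x) = c (a + b * y))))"
  using assms(2)
proof (induction U)
  case empty
  have "\<exists>a b. b > 0 \<and> (\<forall>y\<in>P. a + b * y \<in> P \<and> \<pi> (a + b * y) = \<pi> y) \<and>
        (\<forall>x\<in>P. \<forall>y\<in>P. \<pi> x \<in> {} \<longrightarrow> \<pi> y = \<pi> x \<longrightarrow> c (a + b * x) = c (a + b * y))" for c :: "nat \<Rightarrow> nat"
    by (rule exI[of _ 0], rule exI[of _ 1]) simp
  then show ?case using assms(1) by blast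
next
  case (insert v U)
  then obtain P1 \<pi>1 where 1: "faithful P1 \<pi>1" "\<And>c :: nat \<Rightarrow> nat. (\<forall>x\<in>P1. c x < r) \<Longrightarrow>
     (\<exists>a b. b > 0 \<and> (\<forall>y\<in>P. a + b * y \<in> P1 \<and> \<pi>1 (a + b * y) = \<pi> y) \<and>
        (\<forall>x\<in>P. \<forall>y\<in>P. \<pi> x \<in> U \<longrightarrow> \<pi> y = \<pi> x \<longrightarrow> c (a + b * x) = c (a + b * y)))"
    by blast
  obtain P2 \<pi>2 where 2: "faithful P2 \<pi>2" "\<And>c :: nat \<Rightarrow> nat. (\<forall>x\<in>P2. c x < r) \<Longrightarrow>
     (\<exists>a b. b > 0 \<and> (\<forall>y\<in>P1. a + b * y \<in> P2 \<and> \<pi>2 (a + b * y) = \<pi>1 y) \<and>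
        (\<forall>x\<in>P1. \<forall>y\<in>P1. \<pi>1 x = v \<longrightarrow> \<pi>1 y = v \<longrightarrow> c (a + b * x) = c (a + b * y)))"
    using partite_amalgamation[OF 1(1) assms(3), of v] by blast
  have "\<exists>a b. b > 0 \<and> (\<forall>y\<in>P. a + b * y \<in> P2 \<and> \<pi>2 (a + b * y) = \<pi> y) \<and>
        (\<forall>x\<in>P. \<forall>y\<in>P. \<pi> x \<in> insert v U \<longrightarrow> \<pi> y = \<pi> x \<longrightarrow> c (a + b * x) = c (a + b * y))"
    if c: "\<forall>x\<in>P2. c x < r" for c :: "nat \<Rightarrow> nat"
  proof -
    obtain a b where ab: "b > 0" "\<And>y. y \<in> P1 \<Longrightarrow> a + b * y \<in> P2 \<and> \<pi>2 (a + b * y) = \<pi>1 y"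
      "\<And>x y. x \<in> P1 \<Longrightarrow> y \<in> P1 \<Longrightarrow> \<pi>1 x = v \<Longrightarrow> \<pi>1 y = v \<Longrightarrow> c (a + b * x) = c (a + b * y)"
      using 2(2)[OF c] by blast
    have "\<forall>x\<in>P1. c (a + b * x) < r" using c ab(2) by blast
    from 1(2)[OF this] obtain a' b' where ab': "b' > 0"
      "\<And>y. y \<in> P \<Longrightarrow> a' + b' * y \<in> P1 \<and> \<pi>1 (a' + b' * y) = \<pi> y"
      "\<And>x y. x \<in> P \<Longrightarrow> y \<in> P \<Longrightarrow> \<pi> x \<in> U \<Longrightarrow> \<pi> y = \<pi> x \<Longrightarrow> c (a + b * (a' + b' * x)) = c (a + b * (a' + b' * y))"
      by blast
    have eq: "(a + b * a') + (b * b') * y = a + b * (a' + b' * y)" for y by (simp add: algebra_simps)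
    show ?thesis
    proof (intro exI conjI ballI impI)
      show "b * b' > 0" using ab ab' by simp
      show "(a + b * a') + (b * b') * y \<in> P2" "\<pi>2 ((a + b * a') + (b * b') * y) = \<pi> y" if "y \<in> P" for y
        unfolding eq using ab(2) ab'(2)[OF that] by auto
      show "c ((a + b * a') + (b * b') * x) = c ((a + b * a') + (b * b') * y)"
        if "x \<in> P" "y \<in> P" "\<pi> x \<in> insert v U" "\<pi> y = \<pi> x" for x y
        unfolding eq using ab(3) ab'(2)[OF that(1)] ab'(2)[OF that(2)] ab'(3)[OF that(1,2)] that(3,4)
        by (cases "\<pi> x = v") auto
    qed
  qed
  then show ?case using 2(1) by blast
qed

text \<open>Each edge gets its own interval of \<open>k\<close> consecutive integers; separation
  leaves no further progressions of length \<open>k\<close>.\<close>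

lemma initial_system:
  assumes "finite V"
  obtains P \<pi> where "faithful P \<pi>" "\<And>e. e \<in> E \<Longrightarrow> \<exists>S\<subseteq>P. is_AP k S \<and> \<pi> ` S = e"
proof -
  have "finite E" using assms edges by (meson PowI finite_Pow_iff finite_subset subsetI)
  then obtain n and e :: "nat \<Rightarrow> 'v set" where e: "E = e ` {i. i < n}"
    by (metis finite_imp_nat_seg_image_inj_on)
  have "\<exists>g. bij_betw g {..<k} (e i)" if "i < n" for i
  proof -
    have "e i \<in> E" using e that by blast
    then have "card (e i) = k" "finite (e i)" using edges assms finite_subset by blast+
    then show ?thesis using finite_same_card_bij[of "{..<k}" "e i"] by simp
  qed
  then obtain g where g: "\<And>i. i < n \<Longrightarrow> bij_betw (g i) {..<k} (e i)" by metis
  from separated_translates[of "\<lambda>_. {..<k}", OF finite_lessThan k3]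
  obtain N :: "nat \<Rightarrow> nat" where N0: "\<forall>S. S \<subseteq> (\<Union>i. (+) (N i) ` {..<k}) \<longrightarrow> is_AP k S \<longrightarrow> (\<exists>i. S \<subseteq> (+) (N i) ` {..<k})"
    "\<forall>i j. i \<noteq> j \<longrightarrow> (+) (N i) ` {..<k} \<inter> (+) (N j) ` {..<k} = {}"
    by (elim exE conjE) (rule that)
  note N = N0[rule_format]
  let ?b = "\<lambda>i. (+) (N i) ` {..<k}"
  define P where "P = (\<Union>i<n. ?b i)"
  define \<pi> where "\<pi> x = (let i = SOME i. x \<in> ?b i in g i (x - N i))" for x
  have \<pi>: "\<pi> (N i + j) = g i j" if "j < k" for i j
  proof -
    have "(SOME i'. N i + j \<in> ?b i') = i" using that N(2) by (intro some_equality) blast+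
    then show ?thesis by (simp add: \<pi>_def)
  qed
  have \<pi>b: "\<pi> ` ?b i = e i" if "i < n" for i
  proof -
    have "\<pi> ` ?b i = g i ` {..<k}" unfolding image_image using \<pi> by (intro image_cong) auto
    then show ?thesis using g[OF that] by (simp add: bij_betw_def)
  qed
  have cardb: "card (?b i) = k" for i by (simp add: card_image)
  show thesis
  proof
    show "faithful P \<pi>" unfolding faithful_def
    proof (intro conjI allI impI)
      show "finite P" by (simp add: P_def)
      show "\<pi> ` P \<subseteq> V" using \<pi>b edges e by (fastforce simp: P_def)
      fix S assume S: "S \<subseteq> P" "is_AP k S"
      then obtain i where i: "S \<subseteq> ?b i" using N(1)[of S] by (force simp: P_def)
      have "S = ?b i" using i cardb card_is_AP[OF S(2)] by (intro card_subset_eq) auto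
      moreover have "i < n"
      proof -
        have "S \<noteq> {}" using card_is_AP[OF S(2)] k3 by auto
        then obtain x where "x \<in> S" by blast
        then obtain i' where "i' < n" "x \<in> ?b i'" using S(1) by (auto simp: P_def)
        then show ?thesis using N(2)[of i i'] i \<open>x \<in> S\<close> by blast
      qed
      ultimately show "\<pi> ` S \<in> E" using \<pi>b e by auto
    qed
    show "\<exists>S\<subseteq>P. is_AP k S \<and> \<pi> ` S = e'" if e': "e' \<in> E" for e'
    proof -
      obtain i where i: "i < n" "e' = e i" using e' e by auto
      have "is_AP k (?b i)" unfolding is_AP_eq_image by (intro exI[of _ "N i"] exI[of _ 1]) auto
      then show ?thesis using i \<pi>b by (intro exI[of _ "?b i"]) (auto simp: P_def)
    qed
  qed
qed

end

section \<open>Finite sets for each number of colours, and their union\<close>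

lemma finite_Ramsey_sparse_set:
  fixes k r :: nat and \<mu> :: real
  assumes k: "k \<ge> 3" and \<mu>: "0 < \<mu>" "\<mu> < (real k - 1) / real k" and r: "r \<ge> 1"
  shows "\<exists>X. finite X \<and>
    (\<forall>c :: nat \<Rightarrow> nat. (\<forall>x\<in>X. c x < r) \<longrightarrow> (\<exists>S\<subseteq>X. is_AP k S \<and> (\<exists>col. \<forall>x\<in>S. c x = col))) \<and>
    (\<forall>Y\<subseteq>X. \<exists>Z\<subseteq>Y. real (card Z) \<ge> \<mu> * real (card Y) \<and> \<not> contains_AP k Z)"
proof -
  from linear_hypergraph_exists[OF k \<mu>, of r]
  obtain V :: "nat set set" and E where VE:
    "finite V"
    "\<forall>e\<in>E. e \<subseteq> V \<and> card e = k"
    "\<forall>e\<in>E. \<forall>e'\<in>E. \<forall>u w. u \<noteq> w \<longrightarrow> {u, w} \<subseteq> e \<longrightarrow> {u, w} \<subseteq> e' \<longrightarrow> e = e'"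
    "\<forall>c :: nat set \<Rightarrow> nat. (\<forall>v\<in>V. c v < r) \<longrightarrow> (\<exists>e\<in>E. \<exists>col. \<forall>v\<in>e. c v = col)"
    "\<forall>w :: nat set \<Rightarrow> real. (\<forall>v. w v \<ge> 0) \<longrightarrow> (\<exists>I\<subseteq>V. (\<forall>e\<in>E. \<not> e \<subseteq> I) \<and> sum w I \<ge> \<mu> * sum w V)"
    by (elim exE conjE) (rule that)
  interpret linear_hypergraph k V E using k VE(2,3) by unfold_locales simp_all
  obtain P0 \<pi>0 where P0: "faithful P0 \<pi>0" "\<And>e. e \<in> E \<Longrightarrow> \<exists>S\<subseteq>P0. is_AP k S \<and> \<pi>0 ` S = e"
    using initial_system[OF VE(1)] by blast
  obtain X \<pi> where X: "faithful X \<pi>" "\<And>c :: nat \<Rightarrow> nat. (\<forall>x\<in>X. c x < r) \<Longrightarrow>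
     (\<exists>a b. b > 0 \<and> (\<forall>y\<in>P0. a + b * y \<in> X \<and> \<pi> (a + b * y) = \<pi>0 y) \<and>
        (\<forall>x\<in>P0. \<forall>y\<in>P0. \<pi>0 x \<in> V \<longrightarrow> \<pi>0 y = \<pi>0 x \<longrightarrow> c (a + b * x) = c (a + b * y)))"
    using partite_construction[OF P0(1) VE(1) r] by blast
  have finX: "finite X" and XV: "\<pi> ` X \<subseteq> V" using X(1) by (auto simp: faithful_def)
  show ?thesis
  proof (rule exI[of _ X], intro conjI allI impI)
    show "finite X" by (rule finX)
    fix c :: "nat \<Rightarrow> nat" assume c: "\<forall>x\<in>X. c x < r"
    obtain a b where ab: "b > 0" "\<And>y. y \<in> P0 \<Longrightarrow> a + b * y \<in> X"
      "\<And>x y. x \<in> P0 \<Longrightarrow> y \<in> P0 \<Longrightarrow> \<pi>0 x \<in> V \<Longrightarrow> \<pi>0 y = \<pi>0 x \<Longrightarrow> c (a + b * x) = c (a + b * y)"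
      using X(2)[OF c] by blast
    \<comment> \<open>All fibres of the copy of \<open>P0\<close> are monochromatic, so any
      representative will do; a vertex with empty fibre gets colour 0.\<close>
    define f where "f v = (if \<exists>y\<in>P0. \<pi>0 y = v then c (a + b * (SOME y. y \<in> P0 \<and> \<pi>0 y = v)) else 0)" for v
    have f: "f (\<pi>0 y) = c (a + b * y)" if "y \<in> P0" for y
    proof -
      define z where "z = (SOME z. z \<in> P0 \<and> \<pi>0 z = \<pi>0 y)"
      have "z \<in> P0 \<and> \<pi>0 z = \<pi>0 y" unfolding z_def by (rule someI[of _ y]) (use that in simp)
      moreover have "\<pi>0 y \<in> V" using P0(1) that by (auto simp: faithful_def)
      ultimately show ?thesis using ab(3)[OF that, of z] that by (auto simp: f_def z_def[symmetric])
    qed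
    have "f v < r" for v
    proof (cases "\<exists>y\<in>P0. \<pi>0 y = v")
      case True
      then obtain y where "y \<in> P0" "\<pi>0 y = v" by blast
      then show ?thesis using f[of y] ab(2)[of y] c by auto
    qed (use r in \<open>simp add: f_def\<close>)
    then obtain e col where e: "e \<in> E" "\<forall>v\<in>e. f v = col" using VE(4)[rule_format, of f] by blast
    obtain S where S: "S \<subseteq> P0" "is_AP k S" "\<pi>0 ` S = e" using P0(2)[OF e(1)] by blast
    show "\<exists>S\<subseteq>X. is_AP k S \<and> (\<exists>col. \<forall>x\<in>S. c x = col)"
    proof (intro exI conjI)
      show "(\<lambda>y. a + b * y) ` S \<subseteq> X" using S(1) ab(2) by auto
      show "is_AP k ((\<lambda>y. a + b * y) ` S)" by (rule is_AP_affine_image[OF S(2) ab(1)])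
      show "\<forall>x\<in>(\<lambda>y. a + b * y) ` S. c x = col" using e(2) S f by fastforce
    qed
  next
    fix Y assume Y: "Y \<subseteq> X"
    have finY: "finite Y" using Y finX finite_subset by blast
    \<comment> \<open>With fibre sizes as weights, the weight of a vertex set is the size of its
      preimage in \<open>Y\<close>.\<close>
    define w where "w v = real (card {y\<in>Y. \<pi> y = v})" for v
    obtain I where I: "I \<subseteq> V" "\<forall>e\<in>E. \<not> e \<subseteq> I" "sum w I \<ge> \<mu> * sum w V"
      using VE(5)[rule_format, of w] by (auto simp: w_def)
    have count: "sum w J = real (card {y\<in>Y. \<pi> y \<in> J})" if "J \<subseteq> V" for J
    proof -
      have "finite J" using that VE(1) finite_subset by blast
      have "{y\<in>Y. \<pi> y \<in> J} = (\<Union>v\<in>J. {y\<in>Y. \<pi> y = v})" by blast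
      also have "card \<dots> = (\<Sum>v\<in>J. card {y\<in>Y. \<pi> y = v})"
        using \<open>finite J\<close> finY by (intro card_UN_disjoint) auto
      finally show ?thesis by (simp add: w_def)
    qed
    have "{y\<in>Y. \<pi> y \<in> V} = Y" using Y XV by blast
    then have "real (card {y\<in>Y. \<pi> y \<in> I}) \<ge> \<mu> * real (card Y)"
      using I(3) count[OF I(1)] count[of V] by simp
    moreover have "\<not> contains_AP k {y\<in>Y. \<pi> y \<in> I}"
    proof
      assume "contains_AP k {y\<in>Y. \<pi> y \<in> I}"
      then obtain S where S: "S \<subseteq> {y\<in>Y. \<pi> y \<in> I}" "is_AP k S" by (auto simp: contains_AP_def)
      have "S \<subseteq> X" using S(1) Y by blast
      then have "\<pi> ` S \<in> E" using X(1) S(2) by (simp add: faithful_def)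
      then show False using I(2) S(1) by blast
    qed
    ultimately show "\<exists>Z\<subseteq>Y. real (card Z) \<ge> \<mu> * real (card Y) \<and> \<not> contains_AP k Z"
      by (intro exI[of _ "{y\<in>Y. \<pi> y \<in> I}"]) auto
  qed
qed

theorem theorem1p4:
  fixes k :: nat and \<mu> :: real
  assumes "k \<ge> 3" and "0 < \<mu>" and "\<mu> < (real k - 1) / real k"
  shows "\<exists>X :: nat set.
    (\<forall>r :: nat. r \<ge> 1 \<longrightarrow> (\<forall>c :: nat \<Rightarrow> nat. (\<forall>x\<in>X. c x < r) \<longrightarrow>
        (\<exists>P. P \<subseteq> X \<and> is_AP k P \<and> (\<exists>col. \<forall>x\<in>P. c x = col)))) \<and>
    (\<forall>Y. Y \<subseteq> X \<and> finite Y \<longrightarrow>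
        (\<exists>Z. Z \<subseteq> Y \<and> real (card Z) \<ge> \<mu> * real (card Y) \<and> \<not> contains_AP k Z))"
proof -
  \<comment> \<open>Using \<open>Suc r\<close> colours guarantees at least one colour for every
    index \<open>r\<close>.\<close>
  have "\<forall>r. \<exists>X. finite X \<and>
    (\<forall>c :: nat \<Rightarrow> nat. (\<forall>x\<in>X. c x < Suc r) \<longrightarrow> (\<exists>S\<subseteq>X. is_AP k S \<and> (\<exists>col. \<forall>x\<in>S. c x = col))) \<and>
    (\<forall>Y\<subseteq>X. \<exists>Z\<subseteq>Y. real (card Z) \<ge> \<mu> * real (card Y) \<and> \<not> contains_AP k Z)"
    using finite_Ramsey_sparse_set[OF assms] by simp
  then obtain F where F: "\<And>r. finite (F r)"
    "\<And>r (c :: nat \<Rightarrow> nat). (\<forall>x\<in>F r. c x < Suc r) \<Longrightarrow> \<exists>S\<subseteq>F r. is_AP k S \<and> (\<exists>col. \<forall>x\<in>S. c x = col)"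
    "\<And>r Y. Y \<subseteq> F r \<Longrightarrow> \<exists>Z\<subseteq>Y. real (card Z) \<ge> \<mu> * real (card Y) \<and> \<not> contains_AP k Z"
    by metis
  from separated_translates[of F, OF F(1) assms(1)]
  obtain N :: "nat \<Rightarrow> nat" where N0: "\<forall>S. S \<subseteq> (\<Union>i. (+) (N i) ` F i) \<longrightarrow> is_AP k S \<longrightarrow> (\<exists>i. S \<subseteq> (+) (N i) ` F i)"
    "\<forall>i j. i \<noteq> j \<longrightarrow> (+) (N i) ` F i \<inter> (+) (N j) ` F j = {}"
    by (elim exE conjE) (rule that)
  note N = N0[rule_format]
  let ?b = "\<lambda>i. (+) (N i) ` F i"
  have shift: "is_AP k ((+) a ` S)" if "is_AP k S" for a S
    using is_AP_affine_image[OF that, of 1 a] by simp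
  have block: "\<exists>Z\<subseteq>Y. real (card Z) \<ge> \<mu> * real (card Y) \<and> \<not> contains_AP k Z" if Y: "Y \<subseteq> ?b i" for Y i
  proof -
    obtain Y' where Y': "Y' \<subseteq> F i" "Y = (+) (N i) ` Y'" using Y by (meson subset_imageE)
    obtain Z where Z: "Z \<subseteq> Y'" "real (card Z) \<ge> \<mu> * real (card Y')" "\<not> contains_AP k Z"
      using F(3)[OF Y'(1)] by blast
    have "\<not> contains_AP k ((+) (N i) ` Z)"
    proof
      assume "contains_AP k ((+) (N i) ` Z)"
      then obtain S where S: "S \<subseteq> (+) (N i) ` Z" "is_AP k S" by (auto simp: contains_AP_def)
      then obtain S' where S': "S' \<subseteq> Z" "S = (+) (N i) ` S'" by (meson subset_imageE)
      obtain a d where ad: "d > 0" "S = (\<lambda>j. a + j * d) ` {..<k}" using S(2) by (auto simp: is_AP_eq_image)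
      have "a \<in> S" unfolding ad(2) using assms(1) by (intro image_eqI[of _ _ 0]) auto
      then have "N i \<le> a" using S'(2) by auto
      have "S' = (\<lambda>x. x - N i) ` S" unfolding S'(2) image_image by simp
      also have "\<dots> = (\<lambda>j. (a - N i) + j * d) ` {..<k}"
        unfolding ad(2) image_image using \<open>N i \<le> a\<close> by (intro image_cong) auto
      finally have "is_AP k S'" unfolding is_AP_eq_image using ad(1) by blast
      then show False using Z(3) S'(1) by (auto simp: contains_AP_def)
    qed
    then show ?thesis using Z Y' by (intro exI[of _ "(+) (N i) ` Z"]) (auto simp: card_image)
  qed
  show ?thesis
  proof (rule exI[of _ "\<Union>i. ?b i"], intro conjI allI impI)
    fix r :: nat and c :: "nat \<Rightarrow> nat" assume r: "r \<ge> 1" and c: "\<forall>x\<in>\<Union>i. ?b i. c x < r"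
    have "\<forall>x\<in>F (r - 1). c (N (r - 1) + x) < Suc (r - 1)" using c r by auto
    from F(2)[OF this] obtain S col where S: "S \<subseteq> F (r - 1)" "is_AP k S" "\<forall>x\<in>S. c (N (r - 1) + x) = col"
      by blast
    then show "\<exists>P. P \<subseteq> (\<Union>i. ?b i) \<and> is_AP k P \<and> (\<exists>col. \<forall>x\<in>P. c x = col)"
      using shift[OF S(2)] by (intro exI[of _ "(+) (N (r - 1)) ` S"]) auto
  next
    fix Y assume Y: "Y \<subseteq> (\<Union>i. ?b i) \<and> finite Y"
    obtain Z where Z: "\<And>i. Z i \<subseteq> Y \<inter> ?b i" "\<And>i. real (card (Z i)) \<ge> \<mu> * real (card (Y \<inter> ?b i))"
      "\<And>i. \<not> contains_AP k (Z i)" using block[OF Int_lower2] by metis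
    have "\<exists>i. y \<in> ?b i" if "y \<in> Y" for y using Y that by blast
    then obtain h where h: "\<And>y. y \<in> Y \<Longrightarrow> y \<in> ?b (h y)" by metis
    \<comment> \<open>Finitely many blocks already cover \<open>Y\<close>; the sets
      \<open>Z i\<close> chosen in them are disjoint, so their sizes add up.\<close>
    define J where "J = h ` Y"
    have J: "finite J" "Y \<subseteq> (\<Union>i\<in>J. ?b i)" using Y h by (auto simp: J_def)
    have "real (card (\<Union>i\<in>J. Z i)) \<ge> \<mu> * real (card Y)"
    proof -
      have "Y = (\<Union>i\<in>J. Y \<inter> ?b i)" using J by blast
      moreover have "card (\<Union>i\<in>J. Y \<inter> ?b i) = (\<Sum>i\<in>J. card (Y \<inter> ?b i))"
      proof (rule card_UN_disjoint)
        show "\<forall>i\<in>J. \<forall>j\<in>J. i \<noteq> j \<longrightarrow> Y \<inter> ?b i \<inter> (Y \<inter> ?b j) = {}" using N(2) by blast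
      qed (use J(1) Y in auto)
      ultimately have "card Y = (\<Sum>i\<in>J. card (Y \<inter> ?b i))" by simp
      then have "\<mu> * real (card Y) = (\<Sum>i\<in>J. \<mu> * real (card (Y \<inter> ?b i)))" by (simp add: sum_distrib_left)
      also have "\<dots> \<le> (\<Sum>i\<in>J. real (card (Z i)))" using Z(2) by (intro sum_mono)
      also have "\<dots> = real (card (\<Union>i\<in>J. Z i))"
      proof -
        have "finite (Z i)" for i using Z(1)[of i] Y finite_subset by blast
        moreover have "Z i \<inter> Z j = {}" if "i \<noteq> j" for i j using Z(1)[of i] Z(1)[of j] N(2)[OF that] by blast
        ultimately show ?thesis using card_UN_disjoint[of J Z] J(1) by simp
      qed
      finally show ?thesis .
    qed
    moreover have "\<not> contains_AP k (\<Union>i\<in>J. Z i)"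
    proof
      assume "contains_AP k (\<Union>i\<in>J. Z i)"
      then obtain S where S: "S \<subseteq> (\<Union>i\<in>J. Z i)" "is_AP k S" by (auto simp: contains_AP_def)
      have "(\<Union>i\<in>J. Z i) \<subseteq> (\<Union>i. ?b i)"
        by (intro UN_mono subset_UNIV) (rule order_trans[OF Z(1) Int_lower2])
      then obtain i where i: "S \<subseteq> ?b i" using N(1)[OF order_trans[OF S(1)] S(2)] by meson
      have "S \<subseteq> Z i"
      proof
        fix x assume "x \<in> S"
        then obtain j where "x \<in> Z j" using S(1) by blast
        moreover have "j = i" using Z(1)[of j] calculation i \<open>x \<in> S\<close> N(2)[of i j] by blast
        ultimately show "x \<in> Z i" by simp
      qed
      then show False using Z(3)[of i] S(2) by (auto simp: contains_AP_def)
    qed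
    ultimately show "\<exists>Z. Z \<subseteq> Y \<and> real (card Z) \<ge> \<mu> * real (card Y) \<and> \<not> contains_AP k Z"
      using UN_least[of J Z Y] order_trans[OF Z(1) Int_lower1]
      by (intro exI[of _ "\<Union>i\<in>J. Z i"] conjI) simp_all
  qed
qed

end
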